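(* Let $n\ge1$ and $0\le k\le n$ be integers. The centers of $\mathcal B_l(n,k)$ and of $\mathcal B_r(n,k)$ are both isomorphic to $$\frac{\mathbb Z[U_1,\dots,U_n]}{(U_{i_1}\cdots U_{i_{k+1}}:1\le i_1<\cdots<i_{k+1}\le n)},$$ where the element $U_i$ of this ring corresponds to the sum of the $U_i$ generators at all idempotents, i.e. to $\sum_{\mathbf x}U_i\mathbf I_{\mathbf x}$ over $\mathbf x\in V_l(n,k)$ (respectively $\mathbf x\in V_r(n,k)$).
   Context: Let $V(n,k)$ be the set of $k$-element subsets of $\{0,\dots,n\}$. $\mathcal B(n,k)$ is the path algebra over $\mathbb Z$ (paths composed left to right) of the quiver with vertex set $V(n,k)$ and arrows: for $1\le i\le n$, $R_i:\mathbf x\to\mathbf y$ and $L_i:\mathbf y\to\mathbf x$ whenever $\mathbf x\cap\{i-1,i\}=\{i-1\}$ and $\mathbf y=(\mathbf x\setminus\{i-1\})\cup\{i\}$; and $U_i:\mathbf x\to\mathbf x$ for all $\mathbf x$ and all $1\le i\le n$; modulo the relations (whenever the paths make sense) $R_iU_j=U_jR_i$, $L_iU_j=U_jL_i$, $U_iU_j=U_jU_i$; $R_iL_i=U_i$, $L_iR_i=U_i$; $R_iR_j=R_jR_i$, $L_iL_j=L_jL_i$, $L_iR_j=R_jL_i$ for $|i-j|>1$; $R_{i-1}R_i=0$, $L_iL_{i-1}=0$; $U_i\mathbf I_{\mathbf x}=0$ if $\mathbf x\cap\{i-1,i\}=\emptyset$. Here $\mathbf I_{\mathbf x}$ is the trivial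 path at $\mathbf x$. Let $V_l(n,k)$ and $V_r(n,k)$ be the sets of $k$-element subsets of $\{0,\dots,n-1\}$ and of $\{1,\dots,n\}$. Then $\mathcal B_l(n,k)=\bigoplus_{\mathbf x,\mathbf x'\in V_l(n,k)}\mathbf I_{\mathbf x}\mathcal B(n,k)\mathbf I_{\mathbf x'}$ and $\mathcal B_r(n,k)=\bigoplus_{\mathbf x,\mathbf x'\in V_r(n,k)}\mathbf I_{\mathbf x}\mathcal B(n,k)\mathbf I_{\mathbf x'}$. *)

theory Defs
  imports "HOL-Algebra.QuotRing" "HOL-Library.Poly_Mapping" "Graph_Theory.Arc_Walk"
begin

section \<open>Path algebras over the integers\<close>

text \<open>
  A quiver is a \<^type>\<open>pre_digraph\<close>. A path is recorded as (start vertex, list of arrows,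
  end vertex), so that the trivial path at \<open>u\<close> is \<open>(u, [], u)\<close>. The path algebra is the free
  abelian group on the paths, with the bilinear extension of left-to-right concatenation as
  product; a product of paths that do not fit together is zero.
\<close>

type_synonym ('v, 'a) path = "'v \<times> 'a list \<times> 'v"

definition paths :: "('v, 'a) pre_digraph \<Rightarrow> ('v, 'a) path set" where
  "paths Q = {(u, p, v). pre_digraph.awalk Q u p v}"

fun path_times :: "('v, 'a) path \<Rightarrow> ('v, 'a) path \<Rightarrow> (('v, 'a) path \<Rightarrow>\<^sub>0 int)" where
  "path_times (u, p, v) (u', q, w) = (if v = u' then frag_of (u, p @ q, w) else 0)"

definition path_algebra :: "('v, 'a) pre_digraph \<Rightarrow> (('v, 'a) path \<Rightarrow>\<^sub>0 int) ring" where
  "path_algebra Q =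
     \<lparr>carrier = {f. Poly_Mapping.keys f \<subseteq> paths Q},
      mult = (\<lambda>f g. frag_extend (\<lambda>p. frag_extend (path_times p) g) f),
      one = (\<Sum>u\<in>verts Q. frag_of (u, [], u)),
      zero = 0,
      add = (+)\<rparr>"

lemma path_algebra_simps:
  "carrier (path_algebra Q) = {f. Poly_Mapping.keys f \<subseteq> paths Q}"
  "f \<otimes>\<^bsub>path_algebra Q\<^esub> g = frag_extend (\<lambda>p. frag_extend (path_times p) g) f"
  "\<one>\<^bsub>path_algebra Q\<^esub> = (\<Sum>u\<in>verts Q. frag_of (u, [], u))"
  "\<zero>\<^bsub>path_algebra Q\<^esub> = 0"
  "f \<oplus>\<^bsub>path_algebra Q\<^esub> g = f + g"
  by (simp_all add: path_algebra_def)


section \<open>Centers and idempotent truncations\<close>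

definition ring_center :: "'a ring \<Rightarrow> 'a ring" where
  "ring_center R =
     R\<lparr>carrier := {z \<in> carrier R. \<forall>a\<in>carrier R. z \<otimes>\<^bsub>R\<^esub> a = a \<otimes>\<^bsub>R\<^esub> z}\<rparr>"

text \<open>
  For orthogonal idempotents \<open>e x\<close> this is the internal direct sum of the \<open>e x R e x'\<close> with
  \<open>x, x' \<in> X\<close>. Its unit is the sum of the \<open>e x\<close> over \<open>X\<close>, not the unit of \<open>R\<close>.
\<close>

definition idem_truncation :: "'a ring \<Rightarrow> ('v \<Rightarrow> 'a) \<Rightarrow> 'v set \<Rightarrow> 'a ring" where
  "idem_truncation R e X =
     R\<lparr>carrier := {\<Oplus>\<^bsub>R\<^esub>z\<in>X \<times> X. e (fst z) \<otimes>\<^bsub>R\<^esub> b z \<otimes>\<^bsub>R\<^esub> e (snd z) | b. b \<in> X \<times> X \<rightarrow> carrier R},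
       one := (\<Oplus>\<^bsub>R\<^esub>x\<in>X. e x)\<rparr>"


section \<open>The algebras \<open>B(n,k)\<close>, \<open>B\<^sub>l(n,k)\<close> and \<open>B\<^sub>r(n,k)\<close>\<close>

definition Vset :: "nat \<Rightarrow> nat \<Rightarrow> nat set set" where
  "Vset n k = {x. x \<subseteq> {0..n} \<and> card x = k}"

definition V_l :: "nat \<Rightarrow> nat \<Rightarrow> nat set set" where
  "V_l n k = {x. x \<subseteq> {0..n-1} \<and> card x = k}"

definition V_r :: "nat \<Rightarrow> nat \<Rightarrow> nat set set" where
  "V_r n k = {x. x \<subseteq> {1..n} \<and> card x = k}"

datatype label = Rlab nat | Llab nat | Ulab nat

text \<open>An arrow is a triple (label, source, target).\<close>

type_synonym arrow = "label \<times> nat set \<times> nat set"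

text \<open>\<open>right_move i x y\<close>: there are arrows \<open>R\<^sub>i : x \<rightarrow> y\<close> and \<open>L\<^sub>i : y \<rightarrow> x\<close> (for \<open>i \<ge> 1\<close>).\<close>

definition right_move :: "nat \<Rightarrow> nat set \<Rightarrow> nat set \<Rightarrow> bool" where
  "right_move i x y \<longleftrightarrow> x \<inter> {i-1, i} = {i-1} \<and> y = (x - {i-1}) \<union> {i}"

definition quiver :: "nat \<Rightarrow> nat \<Rightarrow> (nat set, arrow) pre_digraph" where
  "quiver n k =
     \<lparr>verts = Vset n k,
      arcs = {(Rlab i, x, y) | i x y. i \<in> {1..n} \<and> x \<in> Vset n k \<and> y \<in> Vset n k \<and> right_move i x y}
           \<union> {(Llab i, y, x) | i x y. i \<in> {1..n} \<and> x \<in> Vset n k \<and> y \<in> Vset n k \<and> right_move i x y}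
           \<union> {(Ulab i, x, x) | i x. i \<in> {1..n} \<and> x \<in> Vset n k},
      tail = (\<lambda>(c, x, y). x),
      head = (\<lambda>(c, x, y). y)\<rparr>"

text \<open>
  The relations are stated for label words; \<open>relators\<close> imposes them on all parallel paths of
  the quiver that spell the words. Indices need no bounds here, since the labels of arrows lie
  in the range \<open>1..n\<close>.
\<close>

definition word_equations :: "(label list \<times> label list) set" where
  "word_equations =
       {([Rlab i, Ulab j], [Ulab j, Rlab i]) | i j. True}
     \<union> {([Llab i, Ulab j], [Ulab j, Llab i]) | i j. True}
     \<union> {([Ulab i, Ulab j], [Ulab j, Ulab i]) | i j. True}
     \<union> {([Rlab i, Llab i], [Ulab i]) | i. True}
     \<union> {([Llab i, Rlab i], [Ulab i]) | i. True}
     \<union> {([Rlab i, Rlab j], [Rlab j, Rlab i]) | i j. \<bar>int i - int j\<bar> > 1}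
     \<union> {([Llab i, Llab j], [Llab j, Llab i]) | i j. \<bar>int i - int j\<bar> > 1}
     \<union> {([Llab i, Rlab j], [Rlab j, Llab i]) | i j. \<bar>int i - int j\<bar> > 1}"

definition zero_words :: "label list set" where
  "zero_words = {[Rlab (i-1), Rlab i] | i. i \<ge> 1} \<union> {[Llab i, Llab (i-1)] | i. i \<ge> 1}"

definition relators :: "nat \<Rightarrow> nat \<Rightarrow> ((nat set, arrow) path \<Rightarrow>\<^sub>0 int) set" where
  "relators n k =
       {frag_of (x, p, y) - frag_of (x, q, y) | x p q y.
          (x, p, y) \<in> paths (quiver n k) \<and> (x, q, y) \<in> paths (quiver n k) \<and>
          (map fst p, map fst q) \<in> word_equations}
     \<union> {frag_of (x, p, y) | x p y. (x, p, y) \<in> paths (quiver n k) \<and> map fst p \<in> zero_words}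
     \<union> {frag_of (x, [(Ulab i, x, x)], x) | i x.
          i \<in> {1..n} \<and> x \<in> Vset n k \<and> x \<inter> {i-1, i} = {}}"

definition relation_ideal :: "nat \<Rightarrow> nat \<Rightarrow> ((nat set, arrow) path \<Rightarrow>\<^sub>0 int) set" where
  "relation_ideal n k = Idl\<^bsub>path_algebra (quiver n k)\<^esub> (relators n k)"

definition Balg :: "nat \<Rightarrow> nat \<Rightarrow> ((nat set, arrow) path \<Rightarrow>\<^sub>0 int) set ring" where
  "Balg n k = path_algebra (quiver n k) Quot relation_ideal n k"

definition B_class ::
  "nat \<Rightarrow> nat \<Rightarrow> (nat set, arrow) path \<Rightarrow> ((nat set, arrow) path \<Rightarrow>\<^sub>0 int) set" where
  "B_class n k p = relation_ideal n k +>\<^bsub>path_algebra (quiver n k)\<^esub> frag_of p"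

definition idem_at :: "nat \<Rightarrow> nat \<Rightarrow> nat set \<Rightarrow> ((nat set, arrow) path \<Rightarrow>\<^sub>0 int) set" where
  "idem_at n k x = B_class n k (x, [], x)"

definition U_at :: "nat \<Rightarrow> nat \<Rightarrow> nat \<Rightarrow> nat set \<Rightarrow> ((nat set, arrow) path \<Rightarrow>\<^sub>0 int) set" where
  "U_at n k i x = B_class n k (x, [(Ulab i, x, x)], x)"

definition B_l :: "nat \<Rightarrow> nat \<Rightarrow> ((nat set, arrow) path \<Rightarrow>\<^sub>0 int) set ring" where
  "B_l n k = idem_truncation (Balg n k) (idem_at n k) (V_l n k)"

definition B_r :: "nat \<Rightarrow> nat \<Rightarrow> ((nat set, arrow) path \<Rightarrow>\<^sub>0 int) set ring" where
  "B_r n k = idem_truncation (Balg n k) (idem_at n k) (V_r n k)"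


section \<open>The quotient of the polynomial ring\<close>

text \<open>
  A polynomial is a finitely supported map from monomials (finitely supported exponent
  vectors) to coefficients; its product is the convolution of \<^type>\<open>poly_mapping\<close>.
\<close>

definition int_poly_ring :: "nat \<Rightarrow> ((nat \<Rightarrow>\<^sub>0 nat) \<Rightarrow>\<^sub>0 int) ring" where
  "int_poly_ring n =
     \<lparr>carrier = {p. \<forall>m\<in>Poly_Mapping.keys p. Poly_Mapping.keys m \<subseteq> {1..n}},
      mult = (*), one = 1, zero = 0, add = (+)\<rparr>"

definition Uvar :: "nat \<Rightarrow> ((nat \<Rightarrow>\<^sub>0 nat) \<Rightarrow>\<^sub>0 int)" where
  "Uvar i = Poly_Mapping.single (Poly_Mapping.single i 1) 1"

definition monomial_ideal :: "nat \<Rightarrow> nat \<Rightarrow> ((nat \<Rightarrow>\<^sub>0 nat) \<Rightarrow>\<^sub>0 int) set" where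
  "monomial_ideal n k = Idl\<^bsub>int_poly_ring n\<^esub> {\<Prod>i\<in>S. Uvar i | S. S \<subseteq> {1..n} \<and> card S = k + 1}"

definition U_ring :: "nat \<Rightarrow> nat \<Rightarrow> ((nat \<Rightarrow>\<^sub>0 nat) \<Rightarrow>\<^sub>0 int) set ring" where
  "U_ring n k = int_poly_ring n Quot monomial_ideal n k"

definition U_elem :: "nat \<Rightarrow> nat \<Rightarrow> nat \<Rightarrow> ((nat \<Rightarrow>\<^sub>0 nat) \<Rightarrow>\<^sub>0 int) set" where
  "U_elem n k i = monomial_ideal n k +>\<^bsub>int_poly_ring n\<^esub> Uvar i"

end

theory Submission
  imports Defs "HOL-Library.Multiset"
begin

text \<open>
  Call the positions outside a state \<open>x\<close> its holes, and record for each path the number of times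
  it crosses each line, where \<open>U\<^sub>i\<close> counts twice. A path is nonzero iff no two holes of
  its end are joined by crossed lines, and nonzero closed paths are monomials in the \<open>U\<^sub>i\<close>:
  a word that crosses a line twice can be rewritten so that both crossings meet and merge into
  \<open>U\<^sub>i\<close>, unless it moves a particle two steps in one direction, which is zero. That the
  remaining monomials are independent follows from a representation on pairs
  (weight, end state). Commuting with a move that does not join two holes shows that a central
  element has the same coefficient of \<open>U\<^sup>m\<close> at both of its ends. In states with a hole
  at a fixed end of the line, such moves connect all states at which \<open>U\<^sup>m\<close> is nonzero; these
  states exist iff \<open>m\<close> involves at most \<open>k\<close> variables.
\<close>

section \<open>Path algebras\<close>

text \<open>Line \<open>i\<close> joins the positions \<open>i - 1\<close> and \<open>i\<close>. A
  set S of crossed lines thus groups 0, ..., n into n + 1 - |S| blocks, while a state has n + 1 - k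
  holes (for k \<le> n). At most one hole per block is possible iff |S| \<le> k, which is the origin
  of the k + 1 in the ideal. Crossing a line of S moves a hole inside its block, so this occupancy
  condition can be tested at either end of a path. A move across a line outside S merges two
  adjacent blocks, and commuting with it is informative only where the merged block still has at
  most one hole. Connecting the admissible states therefore means letting holes slide within a block
  or into an adjacent empty one, while the hole at the fixed end stays put. The algebra is a
  quotient of a free group and comes without a basis: rewriting yields only spanning, and the
  representation is what excludes further relations. A normal form is needed only for closed paths,
  since commuting with the idempotents puts a central element on the diagonal.\<close>

lemma frag_extend_fun_0 [simp]: "frag_extend (\<lambda>_. 0) a = 0"
  by (simp add: frag_extend_eq_0)

lemma frag_extend_fun_add:
  "frag_extend (\<lambda>x. f x + g x) a = frag_extend f a + frag_extend g a"
  by (simp add: frag_extend_def frag_cmul_distrib2 sum.distrib)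

lemma frag_extend_fun_diff:
  "frag_extend (\<lambda>x. f x - g x) a = frag_extend f a - frag_extend g a"
  using frag_extend_fun_add[of "\<lambda>x. f x - g x" g a] by simp

lemma keys_diff_subset: "Poly_Mapping.keys a \<subseteq> S \<Longrightarrow> Poly_Mapping.keys b \<subseteq> S \<Longrightarrow> Poly_Mapping.keys (a - b) \<subseteq> S"
  by (meson keys_diff Un_least order_trans)

lemma keys_plus_subset: "Poly_Mapping.keys a \<subseteq> S \<Longrightarrow> Poly_Mapping.keys b \<subseteq> S \<Longrightarrow> Poly_Mapping.keys (a + b) \<subseteq> S"
  by (meson Poly_Mapping.keys_add Un_least order_trans)

lemma keys_sum_subset: "(\<And>i. i \<in> A \<Longrightarrow> Poly_Mapping.keys (f i) \<subseteq> S) \<Longrightarrow> Poly_Mapping.keys (sum f A) \<subseteq> S"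
  using keys_sum[of f A] by blast

abbreviation frags_on :: "'a set \<Rightarrow> ('a \<Rightarrow>\<^sub>0 int) set" where
  "frags_on S \<equiv> {f. Poly_Mapping.keys f \<subseteq> S}"

definition path_mult :: "(('v, 'a) path \<Rightarrow>\<^sub>0 int) \<Rightarrow> (('v, 'a) path \<Rightarrow>\<^sub>0 int) \<Rightarrow> (('v, 'a) path \<Rightarrow>\<^sub>0 int)"
  (infixl \<open>\<odot>\<close> 70) where
  "f \<odot> g = frag_extend (\<lambda>p. frag_extend (path_times p) g) f"

lemma path_algebra_mult: "f \<otimes>\<^bsub>path_algebra Q\<^esub> g = f \<odot> g"
  by (simp add: path_algebra_simps path_mult_def)

lemmas path_algebra_ops = path_algebra_mult path_algebra_simps(1,3,4,5)

lemma path_mult_0 [simp]: "0 \<odot> g = 0" "f \<odot> 0 = 0"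
  by (simp_all add: path_mult_def)

lemma path_mult_diff: "(f - f') \<odot> g = f \<odot> g - f' \<odot> g" "f \<odot> (g - g') = f \<odot> g - f \<odot> g'"
  by (simp_all add: path_mult_def frag_extend_diff frag_extend_fun_diff)

lemma path_mult_add: "(f + f') \<odot> g = f \<odot> g + f' \<odot> g" "f \<odot> (g + g') = f \<odot> g + f \<odot> g'"
  by (simp_all add: path_mult_def frag_extend_add frag_extend_fun_add)

lemma path_mult_sum_left: "sum f A \<odot> g = (\<Sum>a\<in>A. f a \<odot> g)"
  by (induction A rule: infinite_finite_induct) (simp_all add: path_mult_add)

lemma path_mult_sum_right: "f \<odot> sum g A = (\<Sum>a\<in>A. f \<odot> g a)"
  by (induction A rule: infinite_finite_induct) (simp_all add: path_mult_add)

lemma path_mult_frag_of: "frag_of (u, p, v) \<odot> frag_of (u', q, w) = (if v = u' then frag_of (u, p @ q, w) else 0)"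
  by (simp add: path_mult_def)

text \<open>Trilinearity reduces the claim to three single paths, where both sides are the
  concatenation or zero; the three nested inductions are this reduction.\<close>

lemma path_mult_assoc: "(f \<odot> g) \<odot> h = f \<odot> (g \<odot> h)"
proof (induction f rule: frag_induction[OF subset_UNIV])
  case (2 p)
  show ?case
  proof (induction g rule: frag_induction[OF subset_UNIV])
    case (2 q)
    show ?case
    proof (induction h rule: frag_induction[OF subset_UNIV])
      case (2 r)
      show ?case
        by (cases p; cases q; cases r) (simp add: path_mult_frag_of)
    qed (simp_all add: path_mult_diff)
  qed (simp_all add: path_mult_diff)
qed (simp_all add: path_mult_diff)

text \<open>Finiteness makes the sum of the trivial paths an honest unit; over an infinite set
  \<open>sum\<close> would return 0.\<close>

locale finite_quiver = wf_digraph Q for Q :: "('v, 'a) pre_digraph" +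
  assumes finite_verts: "finite (verts Q)"
begin

lemma paths_ends: "(u, p, v) \<in> paths Q \<Longrightarrow> u \<in> verts Q \<and> v \<in> verts Q"
  by (auto simp: paths_def)

lemma paths_append: "(u, p, v) \<in> paths Q \<Longrightarrow> (v, q, w) \<in> paths Q \<Longrightarrow> (u, p @ q, w) \<in> paths Q"
  by (auto simp: paths_def)

lemma path_mult_closed:
  assumes "f \<in> frags_on (paths Q)" "g \<in> frags_on (paths Q)"
  shows "f \<odot> g \<in> frags_on (paths Q)"
  using assms(1) unfolding mem_Collect_eq
proof (induction f rule: frag_induction)
  case (one p)
  show ?case using assms(2) unfolding mem_Collect_eq
  proof (induction g rule: frag_induction)
    case (one q)
    then show ?case using \<open>p \<in> paths Q\<close>
      by (cases p; cases q) (auto simp: path_mult_frag_of paths_append)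
  qed (simp_all add: path_mult_diff keys_diff_subset)
qed (simp_all add: path_mult_diff keys_diff_subset)

definition vertex_sum :: "('v, 'a) path \<Rightarrow>\<^sub>0 int" where
  "vertex_sum = (\<Sum>u\<in>verts Q. frag_of (u, [], u))"

lemma vertex_sum_mult: 
  assumes "f \<in> frags_on (paths Q)"
  shows "vertex_sum \<odot> f = f" "f \<odot> vertex_sum = f"
  using assms unfolding mem_Collect_eq
  by (induction f rule: frag_induction)
    (auto simp: vertex_sum_def path_mult_diff path_mult_sum_left path_mult_sum_right path_mult_frag_of
      finite_verts sum_subtractf sum.delta sum.delta' dest: paths_ends)

lemma ring_path_algebra: "ring (path_algebra Q)"
proof (rule ringI)
  show "abelian_group (path_algebra Q)"
  proof (rule abelian_groupI)
    fix x assume "x \<in> carrier (path_algebra Q)"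
    then show "\<exists>y\<in>carrier (path_algebra Q). y \<oplus>\<^bsub>path_algebra Q\<^esub> x = \<zero>\<^bsub>path_algebra Q\<^esub>"
      by (intro bexI[of _ "- x"]) (simp_all add: path_algebra_ops)
  qed (simp_all add: path_algebra_ops keys_plus_subset)
  have "frag_of (u, [], u) \<in> frags_on (paths Q)" if "u \<in> verts Q" for u
    using that by (simp add: paths_def awalk_Nil_iff)
  then have "vertex_sum \<in> frags_on (paths Q)"
    by (simp add: vertex_sum_def keys_sum_subset del: keys_single)
  then show "monoid (path_algebra Q)"
    by (intro monoidI)
      (simp_all only: path_algebra_ops path_mult_assoc path_mult_closed vertex_sum_mult vertex_sum_def[symmetric])
qed (simp_all add: path_algebra_ops path_mult_add)

text \<open>\<open>T p\<close> plays the role of the action of the path \<open>p\<close> on a free module.\<close>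

lemma representation_kernel_ideal:
  fixes T :: "('v, 'a) path \<Rightarrow> 't \<Rightarrow> ('t \<Rightarrow>\<^sub>0 int)"
  defines "A f t \<equiv> frag_extend (\<lambda>p. T p t) f"
  assumes T: "\<And>p q t. p \<in> paths Q \<Longrightarrow> q \<in> paths Q \<Longrightarrow> A (path_times p q) t = frag_extend (T q) (T p t)"
  shows "ideal {f \<in> frags_on (paths Q). \<forall>t. A f t = 0} (path_algebra Q)"
proof -
  interpret P: ring "path_algebra Q" by (rule ring_path_algebra)
  have mult: "A (f \<odot> g) t = frag_extend (A g) (A f t)"
    if "f \<in> frags_on (paths Q)" "g \<in> frags_on (paths Q)" for f g t
    using that(1) unfolding mem_Collect_eq
  proof (induction f rule: frag_induction)
    case (one p)
    show ?case using that(2) unfolding mem_Collect_eq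
    proof (induction g rule: frag_induction)
      case (one q)
      then show ?case using \<open>p \<in> paths Q\<close> T[of p q t]
        by (simp add: path_mult_def A_def)
    qed (simp_all add: A_def path_mult_diff frag_extend_diff frag_extend_fun_diff)
  qed (simp_all add: A_def path_mult_diff frag_extend_diff)
  have uminus: "\<ominus>\<^bsub>path_algebra Q\<^esub> f = - f" if "f \<in> frags_on (paths Q)" for f
    using that by (intro P.minus_equality) (auto simp: path_algebra_ops)
  show ?thesis
  proof (rule idealI[OF ring_path_algebra])
    show "subgroup {f \<in> frags_on (paths Q). \<forall>t. A f t = 0} (add_monoid (path_algebra Q))"
    proof (rule P.add.subgroupI)
      show "{f \<in> frags_on (paths Q). \<forall>t. A f t = 0} \<noteq> {}"
        by (auto simp: A_def intro!: exI[of _ 0])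
    next
      fix f assume "f \<in> {f \<in> frags_on (paths Q). \<forall>t. A f t = 0}"
      then show "\<ominus>\<^bsub>path_algebra Q\<^esub> f \<in> {f \<in> frags_on (paths Q). \<forall>t. A f t = 0}"
        using uminus[of f] by (simp add: A_def frag_extend_minus)
    next
      fix f g assume "f \<in> {f \<in> frags_on (paths Q). \<forall>t. A f t = 0}" "g \<in> {f \<in> frags_on (paths Q). \<forall>t. A f t = 0}"
      then show "f \<oplus>\<^bsub>path_algebra Q\<^esub> g \<in> {f \<in> frags_on (paths Q). \<forall>t. A f t = 0}"
        by (simp add: path_algebra_ops A_def frag_extend_add keys_plus_subset)
    qed (auto simp: path_algebra_ops)
  next
    fix a x assume a: "a \<in> {f \<in> frags_on (paths Q). \<forall>t. A f t = 0}" and "x \<in> carrier (path_algebra Q)"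
    then have x: "x \<in> frags_on (paths Q)" and a': "a \<in> frags_on (paths Q)"
      by (simp_all add: path_algebra_ops)
    \<comment> \<open>In \<open>x \<odot> a\<close> the zero is applied last, as the function
      \<open>A a\<close>; in \<open>a \<odot> x\<close> it is applied first, as the vector
      \<open>A a t\<close>.\<close>
    have "A a = (\<lambda>t. 0)" using a by blast
    then have "A (x \<odot> a) t = 0" "A (a \<odot> x) t = 0" for t
      unfolding mult[OF x a'] mult[OF a' x] by simp_all
    then show "x \<otimes>\<^bsub>path_algebra Q\<^esub> a \<in> {f \<in> frags_on (paths Q). \<forall>t. A f t = 0}"
      "a \<otimes>\<^bsub>path_algebra Q\<^esub> x \<in> {f \<in> frags_on (paths Q). \<forall>t. A f t = 0}"
      using path_mult_closed[OF x a'] path_mult_closed[OF a' x] unfolding path_algebra_ops by blast+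
  qed
qed

end

section \<open>Label words\<close>

text \<open>An arrow is determined by its label and its source, so a path is a start state together
  with a label word. The action is total; whether a letter may be used is left to the separate
  predicate \<open>ok\<close>.\<close>

fun act :: "label \<Rightarrow> nat set \<Rightarrow> nat set" where
  "act (Rlab i) x = insert i (x - {i - 1})"
| "act (Llab i) x = insert (i - 1) (x - {i})"
| "act (Ulab i) x = x"

fun acts :: "label list \<Rightarrow> nat set \<Rightarrow> nat set" where
  "acts [] x = x"
| "acts (l # w) x = acts w (act l x)"

fun arrows :: "nat set \<Rightarrow> label list \<Rightarrow> arrow list" where
  "arrows x [] = []"
| "arrows x (l # w) = (l, x, act l x) # arrows (act l x) w"

lemma acts_append [simp]: "acts (u @ v) x = acts v (acts u x)"
  by (induction u arbitrary: x) auto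

lemma arrows_append: "arrows x (u @ v) = arrows x u @ arrows (acts u x) v"
  by (induction u arbitrary: x) auto

lemma map_fst_arrows [simp]: "map fst (arrows x w) = w"
  by (induction w arbitrary: x) auto

lemma acts_map_Ulab [simp]: "acts (map Ulab us) x = x"
  by (induction us) auto

text \<open>\<open>mv s i\<close> moves a particle across line \<open>i\<close>, to the right iff \<open>s\<close>.\<close>

definition mv :: "bool \<Rightarrow> nat \<Rightarrow> label" where
  "mv s i = (if s then Rlab i else Llab i)"

definition src :: "bool \<Rightarrow> nat \<Rightarrow> nat" where "src s i = (if s then i - 1 else i)"
definition tgt :: "bool \<Rightarrow> nat \<Rightarrow> nat" where "tgt s i = (if s then i else i - 1)"

text \<open>The line that the particle just moved by \<open>mv s i\<close> would cross next.\<close>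

definition nx :: "bool \<Rightarrow> nat \<Rightarrow> nat" where "nx s i = (if s then i + 1 else i - 1)"

fun line :: "label \<Rightarrow> nat" where
  "line (Rlab i) = i" | "line (Llab i) = i" | "line (Ulab i) = i"

fun is_move :: "label \<Rightarrow> bool" where
  "is_move (Ulab i) = False" | "is_move _ = True"

lemma line_mv [simp]: "line (mv s i) = i" and is_move_mv [simp]: "is_move (mv s i)"
  by (simp_all add: mv_def)

lemma is_move_mv_line: "is_move l \<Longrightarrow> \<exists>s. l = mv s (line l)"
  by (cases l) (auto simp: mv_def intro: exI[of _ True] exI[of _ False])

locale strands =
  fixes n k :: nat
begin

abbreviation "Q \<equiv> quiver n k"
abbreviation "V \<equiv> Vset n k"
abbreviation "I \<equiv> relation_ideal n k"

fun ok :: "label \<Rightarrow> nat set \<Rightarrow> bool" where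
  "ok (Rlab i) x \<longleftrightarrow> 1 \<le> i \<and> i \<le> n \<and> i - 1 \<in> x \<and> i \<notin> x"
| "ok (Llab i) x \<longleftrightarrow> 1 \<le> i \<and> i \<le> n \<and> i \<in> x \<and> i - 1 \<notin> x"
| "ok (Ulab i) x \<longleftrightarrow> 1 \<le> i \<and> i \<le> n"

fun oks :: "label list \<Rightarrow> nat set \<Rightarrow> bool" where
  "oks [] x = True"
| "oks (l # w) x = (ok l x \<and> oks w (act l x))"

lemma oks_append [simp]: "oks (u @ v) x \<longleftrightarrow> oks u x \<and> oks v (acts u x)"
  by (induction u arbitrary: x) auto

lemma oks_map_Ulab [simp]: "oks (map Ulab us) x \<longleftrightarrow> set us \<subseteq> {1..n}"
  by (induction us) auto

lemma finite_V: "finite V"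
  by (rule finite_subset[of _ "Pow {0..n}"]) (auto simp: Vset_def)

lemma V_finite: "x \<in> V \<Longrightarrow> finite x"
  by (auto simp: Vset_def intro: finite_subset)

lemma act_V: "x \<in> V \<Longrightarrow> ok l x \<Longrightarrow> act l x \<in> V"
proof -
  assume x: "x \<in> V" and ok: "ok l x"
  have "card (insert j (x - {i})) = card x" if "i \<in> x" "j \<notin> x" for i j
    using that V_finite[OF x] by (metis card.remove card_insert_disjoint finite_Diff Diff_iff)
  with x ok show ?thesis
    by (cases l) (auto simp: Vset_def)
qed

lemma acts_V: "x \<in> V \<Longrightarrow> oks w x \<Longrightarrow> acts w x \<in> V"
  by (induction w arbitrary: x) (auto simp: act_V)

lemma arcs_iff: "(l, x, y) \<in> arcs Q \<longleftrightarrow> x \<in> V \<and> ok l x \<and> y = act l x"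
proof -
  have move: "(a \<in> x \<and> b \<notin> x \<and> y = insert b (x - {a})) \<longleftrightarrow> (b \<in> y \<and> a \<notin> y \<and> x = insert a (y - {b}))"
    if "a \<noteq> b" for a b and x y :: "nat set"
    using that by auto
  \<comment> \<open>\<open>R\<close> starts at the first state of a \<open>right_move\<close> and
    \<open>L\<close> at the second, so the relation is solved in both directions.\<close>
  have ends: "right_move i x y \<longleftrightarrow> i - 1 \<in> x \<and> i \<notin> x \<and> y = insert i (x - {i - 1})"
    "right_move i x y \<longleftrightarrow> i \<in> y \<and> i - 1 \<notin> y \<and> x = insert (i - 1) (y - {i})"
    if "1 \<le> i" for i and x y :: "nat set"
  proof -
    have ne: "i - 1 \<noteq> i" using that by simp
    then have "i \<notin> x" if "x \<inter> {i - 1, i} = {i - 1}"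
      using that by (metis Int_iff insertCI singletonD)
    then have "x \<inter> {i - 1, i} = {i - 1} \<longleftrightarrow> i - 1 \<in> x \<and> i \<notin> x"
      by blast
    then show right: "right_move i x y \<longleftrightarrow> i - 1 \<in> x \<and> i \<notin> x \<and> y = insert i (x - {i - 1})"
      unfolding right_move_def by simp
    show "right_move i x y \<longleftrightarrow> i \<in> y \<and> i - 1 \<notin> y \<and> x = insert (i - 1) (y - {i})"
      unfolding right using move[OF ne] by simp
  qed
  have "(l, x, y) \<in> arcs Q \<longleftrightarrow> x \<in> V \<and> y \<in> V \<and> ok l x \<and> y = act l x"
  proof (cases l)
    case (Rlab i)
    have "(Rlab i, x, y) \<in> arcs Q \<longleftrightarrow> i \<in> {1..n} \<and> x \<in> V \<and> y \<in> V \<and> right_move i x y"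
      by (simp add: quiver_def)
    then show ?thesis using ends(1)[of i x y] unfolding Rlab by auto
  next
    case (Llab i)
    have "(Llab i, x, y) \<in> arcs Q \<longleftrightarrow> i \<in> {1..n} \<and> x \<in> V \<and> y \<in> V \<and> right_move i y x"
      by (auto simp: quiver_def)
    then show ?thesis using ends(2)[of i y x] unfolding Llab by auto
  next
    case (Ulab i)
    then show ?thesis by (auto simp: quiver_def)
  qed
  then show ?thesis using act_V by blast
qed

lemma quiver_ends: "tail Q (l, x, y) = x" "head Q (l, x, y) = y" "verts Q = V"
  by (simp_all add: quiver_def)

sublocale finite_quiver Q
proof
  fix e assume "e \<in> arcs Q"
  then show "tail Q e \<in> verts Q" "head Q e \<in> verts Q"
    by (cases e; auto simp: arcs_iff quiver_ends act_V)+
qed (simp add: quiver_ends finite_V)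

lemma paths_iff: "(x, p, y) \<in> paths Q \<longleftrightarrow> x \<in> V \<and> (\<exists>w. oks w x \<and> p = arrows x w \<and> y = acts w x)"
proof (induction p arbitrary: x)
  case Nil
  have "(\<exists>w. oks w x \<and> [] = arrows x w \<and> y = acts w x) \<longleftrightarrow> y = x"
    by (metis acts.simps(1) arrows.simps(1) map_fst_arrows map_is_Nil_conv oks.simps(1))
  then show ?case by (simp add: paths_def awalk_Nil_iff quiver_ends, blast)
next
  case (Cons e p)
  obtain l x' y' where e: "e = (l, x', y')" by (cases e)
  have "(x, e # p, y) \<in> paths Q \<longleftrightarrow> e \<in> arcs Q \<and> x' = x \<and> (y', p, y) \<in> paths Q"
    by (simp add: paths_def awalk_Cons_iff e quiver_ends, blast)
  also have "\<dots> \<longleftrightarrow> x \<in> V \<and> ok l x \<and> x' = x \<and> y' = act l x \<and> (\<exists>w. oks w y' \<and> p = arrows y' w \<and> y = acts w y')"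
    unfolding e arcs_iff Cons.IH using act_V by blast
  also have "\<dots> \<longleftrightarrow> x \<in> V \<and> (\<exists>w. oks w x \<and> e # p = arrows x w \<and> y = acts w x)"
  proof -
    have "(\<exists>w. oks w x \<and> e # p = arrows x w \<and> y = acts w x) \<longleftrightarrow>
      (\<exists>l w. oks (l # w) x \<and> e # p = arrows x (l # w) \<and> y = acts (l # w) x)"
      by (metis arrows.simps(1) list.distinct(1) neq_Nil_conv)
    then show ?thesis by (auto simp: e)
  qed
  finally show ?case .
qed

text \<open>Words that cannot be followed from \<open>x\<close> give 0. This default lets most
  congruences between words be proved and composed without carrying legality conditions
  along.\<close>

definition W :: "nat set \<Rightarrow> label list \<Rightarrow> (nat set, arrow) path \<Rightarrow>\<^sub>0 int" where
  "W x w = (if x \<in> V \<and> oks w x then frag_of (x, arrows x w, acts w x) else 0)"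

lemma W_paths: "W x w \<in> frags_on (paths Q)"
  by (auto simp: W_def paths_iff)

lemma W_undef: "\<not> (x \<in> V \<and> oks w x) \<Longrightarrow> W x w = 0"
  by (auto simp: W_def)

lemma W_mult: "W x u \<odot> W y v = (if y = acts u x then W x (u @ v) else 0)"
  by (auto simp: W_def path_mult_frag_of arrows_append acts_V)

text \<open>Right multiplication by the sum over all starting states appends \<open>v\<close>
  whatever state \<open>u\<close> ends in, so a right context can be written without naming that
  state.\<close>

lemma W_mult_sum: "W x u \<odot> (\<Sum>z\<in>V. W z v) = W x (u @ v)"
proof (cases "x \<in> V \<and> oks u x")
  case True
  then have "acts u x \<in> V" by (simp add: acts_V)
  then show ?thesis by (simp add: path_mult_sum_right W_mult finite_V sum.delta)
qed (auto simp: W_undef)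

subsection \<open>Words modulo the relations\<close>

lemma relators_paths: "relators n k \<subseteq> carrier (path_algebra Q)"
proof -
  have U: "(x, [(Ulab i, x, x)], x) \<in> paths Q" if "x \<in> V" "i \<in> {1..n}" for x i
    unfolding paths_iff using that by (intro conjI exI[of _ "[Ulab i]"]) auto
  have diff: "frag_of p - frag_of q \<in> frags_on (paths Q)" if "p \<in> paths Q" "q \<in> paths Q" for p q
    using that keys_diff_subset[of "frag_of p" "paths Q" "frag_of q"] by simp
  show ?thesis
    unfolding path_algebra_ops
  proof
    fix r assume "r \<in> relators n k"
    then consider p q where "r = frag_of p - frag_of q" "p \<in> paths Q" "q \<in> paths Q"
      | p where "r = frag_of p" "p \<in> paths Q"
      using U unfolding relators_def by blast
    then show "r \<in> frags_on (paths Q)"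
      by cases (use diff in simp_all)
  qed
qed

lemma I_ideal: "ideal I (path_algebra Q)"
  unfolding relation_ideal_def by (intro ring.genideal_ideal ring_path_algebra relators_paths)

lemma relators_I: "r \<in> relators n k \<Longrightarrow> r \<in> I"
  unfolding relation_ideal_def using ring.genideal_self[OF ring_path_algebra relators_paths] by blast

lemma I_paths: "a \<in> I \<Longrightarrow> a \<in> frags_on (paths Q)"
  using ideal.Icarr[OF I_ideal] by (simp add: path_algebra_ops)

lemma path_algebra_minus: "f \<in> frags_on (paths Q) \<Longrightarrow> \<ominus>\<^bsub>path_algebra Q\<^esub> f = - f"
  by (intro abelian_group.minus_equality ring.is_abelian_group ring_path_algebra) (auto simp: path_algebra_ops)

lemma I_0 [simp]: "0 \<in> I"
  using additive_subgroup.zero_closed[OF ideal.axioms(1)[OF I_ideal]] by (simp add: path_algebra_ops)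

lemma I_add: "a \<in> I \<Longrightarrow> b \<in> I \<Longrightarrow> a + b \<in> I"
  using additive_subgroup.a_closed[OF ideal.axioms(1)[OF I_ideal]] by (simp add: path_algebra_ops)

lemma I_minus: "a \<in> I \<Longrightarrow> - a \<in> I"
  using additive_subgroup.a_inv_closed[OF ideal.axioms(1)[OF I_ideal]] path_algebra_minus I_paths by metis

lemma I_diff: "a \<in> I \<Longrightarrow> b \<in> I \<Longrightarrow> a - b \<in> I"
  using I_add[OF _ I_minus] by force

lemma I_sum: "(\<And>i. i \<in> A \<Longrightarrow> f i \<in> I) \<Longrightarrow> sum f A \<in> I"
  by (induction A rule: infinite_finite_induct) (auto intro: I_add)

lemma I_cmul: "a \<in> I \<Longrightarrow> frag_cmul c a \<in> I"
  by (rule frag_closure_minus_cmul) (auto intro: I_diff)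

lemma I_mult_left: "a \<in> I \<Longrightarrow> f \<in> frags_on (paths Q) \<Longrightarrow> f \<odot> a \<in> I"
  using ideal.I_l_closed[OF I_ideal] by (simp add: path_algebra_ops)

lemma I_mult_right: "a \<in> I \<Longrightarrow> f \<in> frags_on (paths Q) \<Longrightarrow> a \<odot> f \<in> I"
  using ideal.I_r_closed[OF I_ideal] by (simp add: path_algebra_ops)

definition null :: "nat set \<Rightarrow> label list \<Rightarrow> bool" where "null x u \<longleftrightarrow> W x u \<in> I"

definition eqv :: "nat set \<Rightarrow> label list \<Rightarrow> label list \<Rightarrow> bool" where "eqv x u v \<longleftrightarrow> W x u - W x v \<in> I"

lemma eqv_refl [simp]: "eqv x u u"
  by (simp add: eqv_def)

lemma eqv_sym: "eqv x u v \<Longrightarrow> eqv x v u"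
  using I_minus by (force simp: eqv_def)

lemma eqv_trans [trans]: "eqv x u v \<Longrightarrow> eqv x v w \<Longrightarrow> eqv x u w"
  using I_add by (force simp: eqv_def)

lemma eqv_null: "eqv x u v \<Longrightarrow> null x v \<Longrightarrow> null x u"
  using I_add by (force simp: eqv_def null_def)

lemma W_sum_paths: "(\<Sum>z\<in>V. W z b) \<in> frags_on (paths Q)"
  using W_paths by (simp add: keys_sum_subset)

lemma W_context: 
  assumes "oks a x"
  shows "W x (a @ u @ b) = W x a \<odot> W (acts a x) u \<odot> (\<Sum>z\<in>V. W z b)"
  by (simp add: W_mult W_mult_sum)

lemma I_context: "f \<in> I \<Longrightarrow> W x a \<odot> f \<odot> (\<Sum>z\<in>V. W z b) \<in> I"
  by (intro I_mult_right I_mult_left W_paths W_sum_paths)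

lemma eqv_context: "eqv (acts a x) u v \<Longrightarrow> eqv x (a @ u @ b) (a @ v @ b)"
  unfolding eqv_def
  using I_context[of "W (acts a x) u - W (acts a x) v" x a b]
  by (cases "oks a x") (simp_all add: W_context W_undef path_mult_diff)

lemma null_context: "null (acts a x) u \<Longrightarrow> null x (a @ u @ b)"
  unfolding null_def
  using I_context[of "W (acts a x) u" x a b]
  by (cases "oks a x") (simp_all add: W_context W_undef)

text \<open>Multiplying a congruence by the idempotent at the end of its left side kills the right
  side unless both words end in the same state.\<close>

lemma eqv_ends:
  assumes "x \<in> V" "oks u x" "eqv x u v" "\<not> null x u"
  shows "oks v x" "acts v x = acts u x"
proof -
  show "oks v x"
    using assms by (metis W_undef diff_0_right eqv_def null_def)
  have "(W x u - W x v) \<odot> W (acts u x) [] \<in> I"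
    using assms(3) by (intro I_mult_right W_paths) (simp add: eqv_def)
  then have "W x u - W x v \<odot> W (acts u x) [] \<in> I"
    by (simp add: path_mult_diff W_mult[of x u])
  then show "acts v x = acts u x"
    using assms(4) by (auto simp: W_mult null_def split: if_splits)
qed

text \<open>A word equation yields a relator only if both words are paths with the same end; if
  neither is legal, both sides are 0. The case of a single legal word has to be excluded, because
  \<open>U\<close> is legal in states where \<open>R\<close> or \<open>L\<close> is not.\<close>

lemma eqv_word_equation:
  assumes "(u, v) \<in> word_equations" "oks u x \<longleftrightarrow> oks v x" "acts u x = acts v x"
  shows "eqv x u v"
proof (cases "x \<in> V \<and> oks u x")
  case True
  then have "(x, arrows x u, acts u x) \<in> paths Q" "(x, arrows x v, acts u x) \<in> paths Q"
    using assms unfolding paths_iff by metis+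
  then have "frag_of (x, arrows x u, acts u x) - frag_of (x, arrows x v, acts u x) \<in> relators n k"
    using assms(1) unfolding relators_def by (intro UnI1) (auto intro!: exI)
  then show ?thesis
    using True assms by (simp add: eqv_def W_def relators_I)
next
  case False
  then show ?thesis using assms by (simp add: eqv_def W_undef)
qed

lemma null_zero_word:
  assumes "u \<in> zero_words"
  shows "null x u"
proof (cases "x \<in> V \<and> oks u x")
  case True
  then have "(x, arrows x u, acts u x) \<in> paths Q"
    unfolding paths_iff by metis
  then have "frag_of (x, arrows x u, acts u x) \<in> relators n k"
    using assms unfolding relators_def by (intro UnI1[OF UnI2]) (auto intro!: exI)
  then show ?thesis
    using True by (simp add: null_def W_def relators_I)
qed (simp add: null_def W_undef)

lemma null_Ulab:
  assumes "i - 1 \<notin> x" "i \<notin> x"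
  shows "null x [Ulab i]"
proof (cases "x \<in> V \<and> i \<in> {1..n}")
  case True
  then have "frag_of (x, [(Ulab i, x, x)], x) \<in> relators n k"
    using assms unfolding relators_def by (intro UnI2) auto
  then show ?thesis
    using True by (simp add: null_def W_def relators_I)
next
  case False
  then show ?thesis by (auto simp: null_def W_def)
qed

section \<open>Elementary commutation and cancellation of moves\<close>

lemma ok_mv: "ok (mv s i) x \<longleftrightarrow> 1 \<le> i \<and> i \<le> n \<and> src s i \<in> x \<and> tgt s i \<notin> x"
  by (auto simp: mv_def src_def tgt_def)

lemma act_mv: "act (mv s i) x = insert (tgt s i) (x - {src s i})"
  by (simp add: mv_def src_def tgt_def)

lemma eqv_Ulab_swap: "eqv x [l, Ulab j] [Ulab j, l]"
  by (rule eqv_word_equation; cases l) (auto simp: word_equations_def)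

lemma eqv_move_swap:
  assumes "\<bar>int i - int j\<bar> > 1"
  shows "eqv x [mv s i, mv t j] [mv t j, mv s i]"
proof -
  have ends: "oks [mv s i, mv t j] x \<longleftrightarrow> oks [mv t j, mv s i] x" 
    if "\<bar>int i - int j\<bar> > 1" for s t i j
    using that by (cases i; cases j; cases s; cases t) (auto simp: mv_def)
  have ends': "acts [mv s i, mv t j] x = acts [mv t j, mv s i] x" 
    if "\<bar>int i - int j\<bar> > 1" for s t i j
    using that by (cases i; cases j; cases s; cases t) (auto simp: mv_def)
  show ?thesis
  \<comment> \<open>Of the mixed pairs only the form with \<open>L\<close> before \<open>R\<close>
    is a left-hand side; \<open>R\<close> before \<open>L\<close> is reached by reading that
    equation backwards.\<close>
  proof (cases "s \<longrightarrow> t")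
    case True
    then have "([mv s i, mv t j], [mv t j, mv s i]) \<in> word_equations"
      using assms by (auto simp: word_equations_def mv_def)
    then show ?thesis using ends ends' assms by (blast intro: eqv_word_equation)
  next
    case False
    then have "([mv t j, mv s i], [mv s i, mv t j]) \<in> word_equations"
      using assms by (auto simp: word_equations_def mv_def)
    then show ?thesis using ends ends' assms by (blast intro: eqv_word_equation eqv_sym)
  qed
qed

lemma eqv_move_back:
  assumes "ok (mv s i) x"
  shows "eqv x [mv s i, mv (\<not> s) i] [Ulab i]"
  using assms by (intro eqv_word_equation) (auto simp: word_equations_def mv_def)

lemma null_move_on: "null x [mv s i, mv s (nx s i)]"
proof (cases "i = 0")
  case True
  then show ?thesis by (auto simp: null_def W_def mv_def)
next
  case False
  then have "[mv s i, mv s (nx s i)] \<in> zero_words"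
    by (cases s) (force simp: zero_words_def mv_def nx_def)+
  then show ?thesis by (rule null_zero_word)
qed

lemma eqv_swap_through:
  assumes "\<And>l x. l \<in> set w \<Longrightarrow> eqv x [l, m] [m, l]"
  shows "eqv x (w @ [m]) (m # w)"
  using assms
proof (induction w arbitrary: x)
  case (Cons l w)
  have 1: "eqv x ([l] @ (w @ [m]) @ []) ([l] @ (m # w) @ [])"
    by (intro eqv_context Cons) simp
  have 2: "eqv x ([] @ [l, m] @ w) ([] @ [m, l] @ w)"
    by (intro eqv_context Cons) simp
  show ?case using eqv_trans[OF 1[simplified] 2[simplified]] by simp
qed simp

lemma eqv_Ulab_through: "eqv x (w @ [Ulab j]) (Ulab j # w)"
  by (rule eqv_swap_through) (rule eqv_Ulab_swap)

lemma eqv_through_Ulabs: "eqv x (map Ulab us @ w) (w @ map Ulab us)"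
proof (induction us)
  case (Cons u us)
  have 1: "eqv x ([Ulab u] @ (map Ulab us @ w) @ []) ([Ulab u] @ (w @ map Ulab us) @ [])"
    by (intro eqv_context) (simp add: Cons)
  have 2: "eqv x ([] @ (Ulab u # w) @ map Ulab us) ([] @ (w @ [Ulab u]) @ map Ulab us)"
    by (intro eqv_context eqv_sym[OF eqv_Ulab_through])
  show ?case using eqv_trans[OF 1[simplified] 2[simplified]] by simp
qed simp

lemma eqv_Ulabs_perm:
  "mset us = mset vs \<Longrightarrow> eqv x (map Ulab us) (map Ulab vs)"
proof (induction us arbitrary: vs)
  case (Cons u us)
  then have "u \<in> set vs" using mset_eq_setD by fastforce
  then obtain a b where vs: "vs = a @ u # b" by (meson split_list)
  have 1: "eqv x ([Ulab u] @ map Ulab us @ []) ([Ulab u] @ map Ulab (a @ b) @ [])"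
    by (intro eqv_context) (use Cons.IH[of "a @ b"] Cons.prems vs in simp)
  have 2: "eqv x ([] @ (Ulab u # map Ulab a) @ map Ulab b) ([] @ (map Ulab a @ [Ulab u]) @ map Ulab b)"
    by (intro eqv_context eqv_sym[OF eqv_Ulab_through])
  show ?case using eqv_trans[OF 1[simplified] 2[simplified]] by (simp add: vs)
qed simp

section \<open>Reduction of words to U letters and moves across distinct lines\<close>

lemma mem_act_other:
  assumes "line l \<noteq> p" "line l \<noteq> p + 1"
  shows "p \<in> act l x \<longleftrightarrow> p \<in> x"
  using assms by (cases l) auto

lemma mem_acts_other:
  assumes "\<And>l. l \<in> set w \<Longrightarrow> line l \<noteq> p \<and> line l \<noteq> p + 1"
  shows "p \<in> acts w x \<longleftrightarrow> p \<in> x"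
  using assms by (induction w arbitrary: x) (auto simp: mem_act_other)

lemma mem_act_toggle:
  assumes "ok l x" "is_move l" "p = line l \<or> p = line l - 1"
  shows "p \<in> act l x \<longleftrightarrow> p \<notin> x"
  using assms by (cases l) auto

lemma mem_acts_toggle:
  assumes "oks (a @ m # b) x" "is_move m" "p = line m \<or> p = line m - 1"
    and "\<And>l. l \<in> set a \<union> set b \<Longrightarrow> line l \<noteq> p \<and> line l \<noteq> p + 1"
  shows "p \<in> acts (a @ m # b) x \<longleftrightarrow> p \<notin> x"
proof -
  have "p \<in> acts (a @ m # b) x \<longleftrightarrow> p \<in> act m (acts a x)"
    using assms(4) by (simp add: mem_acts_other)
  also have "\<dots> \<longleftrightarrow> p \<notin> acts a x"
    using assms(1-3) by (intro mem_act_toggle) auto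
  also have "\<dots> \<longleftrightarrow> p \<notin> x"
    using assms(4) by (simp add: mem_acts_other)
  finally show ?thesis .
qed

text \<open>In the accumulator \<open>a\<close> we collect the letters behind line \<open>i\<close>; they commute with
  the second crossing, the letters ahead commute with the first one.\<close>

lemma null_two_steps_aux:
  assumes "\<And>l. l \<in> set a \<Longrightarrow> is_move l \<and> (if s then line l < i else i < line l)"
    and "\<And>l. l \<in> set q \<Longrightarrow> is_move l \<and> line l \<noteq> i \<and> line l \<noteq> nx s i"
    and "1 \<le> i"
  shows "null x (mv s i # a @ q @ [mv s (nx s i)])"
  using assms(1,2)
proof (induction q arbitrary: a x)
  case Nil
  have "eqv x [l, mv s (nx s i)] [mv s (nx s i), l]" if l: "l \<in> set a" for l x
  proof -
    obtain t where t: "l = mv t (line l)" using Nil(1)[OF l] is_move_mv_line by blast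
    show ?thesis
      by (subst (1 2) t, rule eqv_move_swap) (use Nil(1)[OF l] assms(3) in \<open>auto simp: nx_def split: if_splits\<close>)
  qed
  then have "eqv x ([mv s i] @ (a @ [mv s (nx s i)]) @ []) ([mv s i] @ (mv s (nx s i) # a) @ [])"
    by (intro eqv_context eqv_swap_through)
  moreover have "null x ([] @ [mv s i, mv s (nx s i)] @ a)"
    by (intro null_context null_move_on)
  ultimately show ?case
    using eqv_null by simp
next
  case (Cons e q)
  show ?case
  proof (cases "if s then line e < i else i < line e")
    case True
    have "null x (mv s i # (a @ [e]) @ q @ [mv s (nx s i)])"
      by (rule Cons.IH) (use Cons.prems True in auto)
    then show ?thesis by simp
  next
    case False
    obtain t where t: "e = mv t (line e)" using Cons.prems(2)[of e] is_move_mv_line by auto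
    have swap: "eqv x [l, e] [e, l]" if l: "l \<in> set (mv s i # a)" for l x
    proof -
      obtain t' where t': "l = mv t' (line l)" using l Cons.prems(1) is_move_mv_line by fastforce
      have "line e \<noteq> i" "line e \<noteq> nx s i" using Cons.prems(2)[of e] by auto
      \<comment> \<open>The letter \<open>e\<close> is ahead of line \<open>i\<close> but not on the
        next line, so it is at distance at least 2 from \<open>i\<close> and from everything behind
        \<open>i\<close>.\<close>
      then have "\<bar>int (line l) - int (line e)\<bar> > 1"
        using l Cons.prems(1)[of l] False assms(3) by (auto simp: nx_def split: if_splits)
      then show ?thesis
        using eqv_move_swap[of "line l" "line e" x t' t] t t' by metis
    qed
    have "eqv x ([] @ ((mv s i # a) @ [e]) @ q @ [mv s (nx s i)]) ([] @ (e # mv s i # a) @ q @ [mv s (nx s i)])"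
      by (intro eqv_context eqv_swap_through swap)
    moreover have "null (acts [e] x) (mv s i # a @ q @ [mv s (nx s i)])"
      by (rule Cons.IH) (use Cons.prems in auto)
    then have "null x ([e] @ (mv s i # a @ q @ [mv s (nx s i)]) @ [])"
      by (rule null_context)
    ultimately show ?thesis
      using eqv_null by simp
  qed
qed

text \<open>Follow the particle that makes the first crossing. If it is moved in between, the first
  such letter must carry it on in the same direction, which gives zero. Otherwise the second
  crossing must bring it back, all letters in between are far from line \<open>i\<close>, and the
  two crossings can be brought together.\<close>

lemma reduce_pair:
  assumes oks: "oks (mv s i # q @ [mv t i]) x"
    and moves: "\<And>l. l \<in> set q \<Longrightarrow> is_move l" and dist: "distinct (map line q)" and i: "i \<notin> line ` set q"
  shows "null x (mv s i # q @ [mv t i]) \<or> eqv x (mv s i # q @ [mv t i]) (Ulab i # q)"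
proof -
  define y where "y = act (mv s i) x"
  have i1: "1 \<le> i" and y: "tgt s i \<in> y" "src s i \<notin> y" and okq: "oks q y" and okt: "ok (mv t i) (acts q y)"
    and ok: "ok (mv s i) x"
    using oks by (auto simp: y_def ok_mv act_mv src_def tgt_def)
  show ?thesis
  proof (cases "nx s i \<in> line ` set q")
    case True
    then have "\<exists>l\<in>set q. line l = nx s i" by force
    from split_list_first_propE[OF this] obtain a m b where
      q: "q = a @ m # b" "line m = nx s i" "\<And>l. l \<in> set a \<Longrightarrow> line l \<noteq> nx s i"
      by metis
    have "tgt s i \<in> acts a y \<longleftrightarrow> tgt s i \<in> y"
      by (rule mem_acts_other) (use q i i1 in \<open>auto simp: tgt_def nx_def\<close>)
    then have tgt: "tgt s i \<in> acts a y" using y by simp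
    obtain s' where m: "m = mv s' (nx s i)" using moves[of m] is_move_mv_line[of m] q by auto
    have "ok m (acts a y)" using okq q by simp
    \<comment> \<open>The particle still stands at \<open>tgt s i\<close>, so crossing the next line
      the other way would end in an occupied position.\<close>
    then have "s' = s"
      using tgt i1 unfolding m ok_mv by (cases s; cases s') (auto simp: tgt_def src_def nx_def)
    have "null x (mv s i # [] @ a @ [mv s (nx s i)])"
      by (rule null_two_steps_aux) (use q moves i i1 in auto)
    then have "null x ([] @ (mv s i # a @ [mv s (nx s i)]) @ b @ [mv t i])"
      by (intro null_context) simp
    then show ?thesis by (simp add: q m \<open>s' = s\<close>)
  next
    case False
    then have lines: "line l \<noteq> nx s i" "line l \<noteq> i" if "l \<in> set q" for l
      using i that by (metis image_eqI)+
    have "tgt s i \<in> acts q y \<longleftrightarrow> tgt s i \<in> y"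
      by (rule mem_acts_other) (use lines i1 in \<open>auto simp: tgt_def nx_def\<close>)
    then have t: "t = (\<not> s)" and src: "src s i \<notin> acts q y"
      using okt y by (auto simp: ok_mv src_def tgt_def split: if_splits)
    \<comment> \<open>A crossing of this line would toggle \<open>src s i\<close>, which is empty
      after the first crossing and must be empty for the return; \<open>dist\<close> forbids a
      second crossing that would toggle it back.\<close>
    have prev: "line l \<noteq> nx (\<not> s) i" if "l \<in> set q" for l
    proof
      assume l: "line l = nx (\<not> s) i"
      obtain a b where q: "q = a @ l # b" using split_list[OF \<open>l \<in> set q\<close>] by blast
      have "line l' \<noteq> line l" "line l' \<noteq> i" if "l' \<in> set a \<union> set b" for l'
        using that dist lines(2)[of l'] unfolding q by (force simp: image_iff)+
      moreover have "1 \<le> line l" using okq by (cases l) (auto simp: q)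
      ultimately have "src s i \<in> acts (a @ l # b) y \<longleftrightarrow> src s i \<notin> y"
        using okq i1 l moves[of l] unfolding q
        by (intro mem_acts_toggle) (auto simp: src_def nx_def split: if_splits)
      then show False using src y q by simp
    qed
    have swap: "eqv x [l, mv s i] [mv s i, l]" if l: "l \<in> set q" for l x
    proof -
      obtain t' where t': "l = mv t' (line l)" using l moves is_move_mv_line by blast
      have "line l \<noteq> nx s i" "line l \<noteq> nx (\<not> s) i" "line l \<noteq> i"
        using l lines prev by auto
      then have "\<bar>int (line l) - int i\<bar> > 1"
        using i1 by (auto simp: nx_def split: if_splits)
      then show ?thesis using eqv_move_swap[of "line l" i x t' s] t' by metis
    qed
    have same: "src s i \<in> acts q x \<longleftrightarrow> src s i \<in> x" "tgt s i \<in> acts q x \<longleftrightarrow> tgt s i \<in> x"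
      by (rule mem_acts_other; use lines prev i1 in \<open>auto simp: src_def tgt_def nx_def split: if_splits\<close>)+
    have 1: "eqv x ([] @ (mv s i # q) @ [mv t i]) ([] @ (q @ [mv s i]) @ [mv t i])"
      by (intro eqv_context eqv_sym[OF eqv_swap_through] swap)
    have 2: "eqv x (q @ [mv s i, mv t i] @ []) (q @ [Ulab i] @ [])"
      unfolding t by (intro eqv_context eqv_move_back) (use ok same in \<open>auto simp: ok_mv\<close>)
    show ?thesis
      using eqv_trans[OF 1[simplified] eqv_trans[OF 2[simplified] eqv_Ulab_through]] by simp
  qed
qed

text \<open>Induction on the last letter. A U goes to the front, and a move across a new line stays.
  A move across an old line meets its unique partner in \<open>q\<close>, and
  \<open>reduce_pair\<close> treats the segment from there on. \<open>eqv_ends\<close> provides that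
  the rewritten word is still legal.\<close>

lemma reduce:
  assumes "x \<in> V" "oks p x"
  shows "null x p \<or> (\<exists>us q. eqv x p (map Ulab us @ q) \<and> (\<forall>l\<in>set q. is_move l) \<and> distinct (map line q))"
  using assms(2)
proof (induction p rule: rev_induct)
  case Nil
  have "eqv x [] (map Ulab [] @ [])" by simp
  then show ?case by fastforce
next
  case (snoc c p)
  show ?case
  proof (cases "null x p \<or> null x (p @ [c])")
    case True
    then show ?thesis using null_context[of "[]" x p "[c]"] by auto
  next
    case False
    then obtain us q where eq: "eqv x p (map Ulab us @ q)" and moves: "\<forall>l\<in>set q. is_move l"
      and dist: "distinct (map line q)"
      using snoc by auto
    have "eqv x ([] @ p @ [c]) ([] @ (map Ulab us @ q) @ [c])"
      by (intro eqv_context) (simp add: eq)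
    then have eq': "eqv x (p @ [c]) (map Ulab us @ q @ [c])" by simp
    have ends: "oks (map Ulab us @ q @ [c]) x"
      using eqv_ends[OF assms(1) snoc.prems eq'] False by blast
    show ?thesis
    proof (cases "is_move c")
      case False
      then obtain j where c: "c = Ulab j" by (cases c) auto
      have "eqv x (map Ulab us @ (q @ [c]) @ []) (map Ulab us @ (c # q) @ [])"
        unfolding c by (intro eqv_context eqv_Ulab_through)
      then have "eqv x (p @ [c]) (map Ulab (us @ [j]) @ q)"
        using eqv_trans[OF eq'] by (simp add: c)
      then show ?thesis using moves dist by blast
    next
      case move: True
      show ?thesis
      proof (cases "line c \<in> line ` set q")
        case False
        then have "distinct (map line (q @ [c]))" "\<forall>l\<in>set (q @ [c]). is_move l"
          using dist moves move by auto
        then show ?thesis using eq' by blast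
      next
        case True
        then obtain m q1 q2 where q: "q = q1 @ m # q2" and m: "line m = line c"
          by (metis imageE split_list)
        obtain s t where st: "m = mv s (line c)" "c = mv t (line c)"
          using is_move_mv_line[OF move] is_move_mv_line[of m] moves q m by auto
        define z where "z = acts (map Ulab us @ q1) x"
        have c: "line c \<notin> line ` set (q1 @ q2)" and d: "distinct (map line (q1 @ q2))"
          using dist m by (auto simp: q)
        have "null z (m # q2 @ [c]) \<or> eqv z (m # q2 @ [c]) (Ulab (line c) # q2)"
          using reduce_pair[of s "line c" q2 t z] ends c d moves unfolding st[symmetric]
          by (auto simp: q z_def)
        then show ?thesis
        proof
          assume "null z (m # q2 @ [c])"
          then have "null x ((map Ulab us @ q1) @ (m # q2 @ [c]) @ [])"
            unfolding z_def by (rule null_context)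
          then show ?thesis using eqv_null[OF eq'] by (simp add: q)
        next
          assume "eqv z (m # q2 @ [c]) (Ulab (line c) # q2)"
          then have 1: "eqv x ((map Ulab us @ q1) @ (m # q2 @ [c]) @ []) ((map Ulab us @ q1) @ (Ulab (line c) # q2) @ [])"
            unfolding z_def by (rule eqv_context)
          have 2: "eqv x (map Ulab us @ (q1 @ [Ulab (line c)]) @ q2) (map Ulab us @ (Ulab (line c) # q1) @ q2)"
            by (intro eqv_context eqv_Ulab_through)
          have "eqv x (p @ [c]) (map Ulab (us @ [line c]) @ q1 @ q2)"
            using eqv_trans[OF eq'] eqv_trans[OF 1[simplified] 2[simplified]] by (simp add: q)
          moreover have "\<forall>l\<in>set (q1 @ q2). is_move l" using moves q by auto
          ultimately show ?thesis using d by blast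
        qed
      qed
    qed
  qed
qed

text \<open>The position just left of the lowest crossed line is touched by exactly one letter, so
  its occupancy changes.\<close>

lemma closed_reduced_Nil:
  assumes "oks q x" "acts q x = x" "\<forall>l\<in>set q. is_move l" "distinct (map line q)"
  shows "q = []"
proof (rule ccontr)
  assume "q \<noteq> []"
  define i where "i = Min (line ` set q)"
  have "i \<in> line ` set q" and min: "\<And>l. l \<in> set q \<Longrightarrow> i \<le> line l"
    using \<open>q \<noteq> []\<close> by (auto simp: i_def)
  then obtain a m b where q: "q = a @ m # b" and m: "line m = i"
    by (metis imageE split_list)
  have "1 \<le> i" using assms(1,3) m by (cases m) (auto simp: q)
  have "i - 1 \<in> acts (a @ m # b) x \<longleftrightarrow> i - 1 \<notin> x"
  proof (rule mem_acts_toggle)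
    fix l assume l: "l \<in> set a \<union> set b"
    then have "line l \<noteq> i" using assms(4) m unfolding q by (force simp: image_iff)
    moreover have "i \<le> line l" using l by (intro min) (auto simp: q)
    ultimately show "line l \<noteq> i - 1 \<and> line l \<noteq> i - 1 + 1" using \<open>1 \<le> i\<close> by auto
  qed (use assms q m in auto)
  then show False using assms(2) q by simp
qed

lemma closed_word:
  assumes "x \<in> V" "oks p x" "acts p x = x"
  shows "null x p \<or> (\<exists>us. set us \<subseteq> {1..n} \<and> eqv x p (map Ulab us))"
proof (cases "null x p")
  case False
  then obtain us q where eq: "eqv x p (map Ulab us @ q)" and q: "\<forall>l\<in>set q. is_move l" "distinct (map line q)"
    using reduce[OF assms(1,2)] by blast
  have "oks (map Ulab us @ q) x" "acts (map Ulab us @ q) x = acts p x"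
    using eqv_ends[OF assms(1,2) eq False] by auto
  then show ?thesis
    using closed_reduced_Nil[OF _ _ q, of x] assms(3) eq by auto
qed simp

text \<open>Slide the left hole rightwards until the two holes are adjacent.\<close>

lemma null_two_holes:
  assumes "a \<notin> x" "b \<notin> x" "a < b" "{a<..b} \<subseteq> set us"
  shows "null x (map Ulab us)"
  using assms
proof (induction "b - a" arbitrary: a x us)
  case (Suc d)
  show ?case
  proof (cases "x \<in> V \<and> set us \<subseteq> {1..n}")
    case True
    define us' where "us' = remove1 (a + 1) us"
    have a1: "a + 1 \<in> set us" using Suc.prems by auto
    then have perm: "eqv x (map Ulab us) (Ulab (a + 1) # map Ulab us')"
      using eqv_Ulabs_perm[of us "(a + 1) # us'" x] by (simp add: us'_def)
    have us': "{a + 1<..b} \<subseteq> set us'"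
      using Suc.prems(4) by (force simp: us'_def)
    consider "b = a + 1" | "b \<noteq> a + 1" "a + 1 \<notin> x" | "b \<noteq> a + 1" "a + 1 \<in> x" by blast
    then show ?thesis
    proof cases
      case 1
      then have "null x ([] @ [Ulab (a + 1)] @ map Ulab us')"
        by (intro null_context null_Ulab) (use Suc.prems in auto)
      then show ?thesis using eqv_null[OF perm] by simp
    next
      case 2
      then show ?thesis using Suc.hyps(1)[of "a + 1" x us] Suc.hyps(2) Suc.prems by force
    next
      case 3
      \<comment> \<open>Expand one U at line \<open>a + 1\<close> as \<open>L\<close> followed by
        \<open>R\<close> and slide the other U letters between the two: there they act in a state
        whose left hole has moved to \<open>a + 1\<close>.\<close>
      let ?l = "mv False (a + 1)" and ?r = "mv True (a + 1)"
      have "null (acts [?l] x) (map Ulab us')"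
        using 3 us' Suc.hyps(2) Suc.prems by (intro Suc.hyps(1)[of "a + 1"]) (auto simp: act_mv src_def tgt_def)
      then have "null x ([?l] @ map Ulab us' @ [?r])"
        by (rule null_context)
      moreover have "ok ?l x"
        using 3 Suc.prems a1 True by (auto simp: ok_mv src_def tgt_def)
      then have "eqv x ([] @ [Ulab (a + 1)] @ map Ulab us') ([] @ [?l, ?r] @ map Ulab us')"
        using eqv_move_back[of False "a + 1" x] by (intro eqv_context) (simp add: eqv_sym)
      moreover have "eqv x ([?l] @ ([?r] @ map Ulab us') @ []) ([?l] @ (map Ulab us' @ [?r]) @ [])"
        by (intro eqv_context eqv_sym[OF eqv_through_Ulabs])
      ultimately have "null x (Ulab (a + 1) # map Ulab us')"
        using eqv_null by simp
      then show ?thesis using eqv_null[OF perm] by simp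
    qed
  next
    case False
    then show ?thesis by (auto simp: null_def W_def)
  qed
qed simp

end

section \<open>A faithful representation\<close>

fun lwt :: "label \<Rightarrow> nat \<Rightarrow>\<^sub>0 nat" where
  "lwt (Rlab i) = Poly_Mapping.single i 1"
| "lwt (Llab i) = Poly_Mapping.single i 1"
| "lwt (Ulab i) = Poly_Mapping.single i 2"

definition wt :: "label list \<Rightarrow> nat \<Rightarrow>\<^sub>0 nat" where
  "wt w = sum_list (map lwt w)"

lemma wt_simps [simp]: "wt [] = 0" "wt (l # w) = lwt l + wt w" "wt (u @ v) = wt u + wt v"
  by (simp_all add: wt_def)

lemma keys_add_nat: "Poly_Mapping.keys (a + b) = Poly_Mapping.keys a \<union> Poly_Mapping.keys (b :: 'a \<Rightarrow>\<^sub>0 nat)"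
  by (auto simp: in_keys_iff lookup_add)

lemma keys_wt [simp]: "Poly_Mapping.keys (wt w) = line ` set w"
proof (induction w)
  case (Cons l w)
  have "Poly_Mapping.keys (lwt l) = {line l}" by (cases l) auto
  with Cons show ?case by (simp add: keys_add_nat)
qed simp

text \<open>Counting U twice is what makes the two equations merging \<open>R\<close> and
  \<open>L\<close> into \<open>U\<close> homogeneous; all other equations only swap two
  letters.\<close>

lemma word_equations_wt: "(u, v) \<in> word_equations \<Longrightarrow> wt u = wt v"
  by (auto simp: word_equations_def single_add[symmetric] numeral_2_eq_2 add.commute)

context strands
begin

text \<open>This is the condition of at most one hole per block:
  \<open>{a<..b} \<subseteq> S\<close> says that all lines between the positions \<open>a\<close>
  and \<open>b\<close> are in \<open>S\<close>. The bound \<open>b \<le> n\<close> is there because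
  numbers beyond \<open>n\<close> lie outside \<open>x\<close> without being holes.\<close>

definition good :: "nat set \<Rightarrow> nat set \<Rightarrow> bool" where
  "good S x \<longleftrightarrow> (\<forall>a b. a < b \<longrightarrow> b \<le> n \<longrightarrow> a \<notin> x \<longrightarrow> b \<notin> x \<longrightarrow> \<not> {a<..b} \<subseteq> S)"

lemma goodD: "good S x \<Longrightarrow> a < b \<Longrightarrow> b \<le> n \<Longrightarrow> a \<notin> x \<Longrightarrow> b \<notin> x \<Longrightarrow> \<not> {a<..b} \<subseteq> S"
  by (auto simp: good_def)

lemma good_mono: "good S' x \<Longrightarrow> S \<subseteq> S' \<Longrightarrow> good S x"
  unfolding good_def by (meson order_trans)

text \<open>The hole at \<open>i\<close> goes to \<open>i - 1\<close> inside its block, since line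
  \<open>i\<close> is in \<open>S\<close>. The facts \<open>left\<close> and \<open>right\<close>
  express that these two positions are joined to the same other positions.\<close>

lemma good_right_move:
  assumes "ok (Rlab i) x" "i \<in> S"
  shows "good S (act (Rlab i) x) \<longleftrightarrow> good S x"
proof -
  let ?y = "insert i (x - {i - 1})"
  have i: "1 \<le> i" "i \<le> n" "i - 1 \<in> x" "i \<notin> x" using assms by auto
  have left: "{a<..b} \<subseteq> S \<longleftrightarrow> {a<..i - 1} \<subseteq> S" if "b = i" "a < i" for a b
  proof -
    have "{a<..b} = insert i {a<..i - 1}" using that i by auto
    then show ?thesis using assms by simp
  qed
  have right: "{i - 1<..b} \<subseteq> S \<longleftrightarrow> {i<..b} \<subseteq> S" if "i \<le> b" for b
  proof -
    have "{i - 1<..b} = insert i {i<..b}" using that i by auto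
    then show ?thesis using assms by simp
  qed
  have "good S ?y" if x: "good S x"
    unfolding good_def
  proof (intro allI impI)
    fix a b assume ab: "a < b" "b \<le> n" "a \<notin> ?y" "b \<notin> ?y"
    consider "a = i - 1" | "b = i - 1" | "a \<noteq> i - 1" "b \<noteq> i - 1" by blast
    then show "\<not> {a<..b} \<subseteq> S"
    proof cases
      case 1
      then have "i < b" "b \<notin> x" using ab i by auto
      then show ?thesis using goodD[OF x, of i b] right[of b] ab i 1 by simp
    next
      case 2
      then have "a < i" "a \<notin> x" using ab i by auto
      then show ?thesis using goodD[OF x, of a i] left[of i a] i 2 by simp
    next
      case 3
      then show ?thesis using goodD[OF x, of a b] ab by auto
    qed
  qed
  moreover have "good S x" if y: "good S ?y"
    unfolding good_def
  proof (intro allI impI)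
    fix a b assume ab: "a < b" "b \<le> n" "a \<notin> x" "b \<notin> x"
    consider "a = i" | "b = i" | "a \<noteq> i" "b \<noteq> i" by blast
    then show "\<not> {a<..b} \<subseteq> S"
    proof cases
      case 1
      then show ?thesis using goodD[OF y, of "i - 1" b] right[of b] ab i by auto
    next
      case 2
      then have "a < i - 1" using ab i by (metis less_Suc_eq Suc_diff_1 le_eq_less_or_eq less_le_trans zero_less_one)
      then show ?thesis using goodD[OF y, of a "i - 1"] left[of b a] ab i 2 by auto
    next
      case 3
      then show ?thesis using goodD[OF y, of a b] ab i by auto
    qed
  qed
  ultimately show ?thesis by auto
qed

lemma good_act:
  assumes "ok l x" "line l \<in> S"
  shows "good S (act l x) \<longleftrightarrow> good S x"
proof (cases l)
  case (Llab i)
  then have "act (Rlab i) (act l x) = x" "ok (Rlab i) (act l x)"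
    using assms(1) by auto
  then show ?thesis using good_right_move[of i "act l x" S] assms(2) Llab by simp
qed (use good_right_move assms in auto)

lemma good_acts: "oks w x \<Longrightarrow> line ` set w \<subseteq> S \<Longrightarrow> good S (acts w x) \<longleftrightarrow> good S x"
  by (induction w arbitrary: x) (auto simp: good_act)

text \<open>The module has the pairs (weight, state) as basis, with those pairs set to zero whose
  state is not \<open>good\<close> for the support of the weight. Testing the end of the path is
  enough, because goodness there implies goodness at every earlier state.\<close>

fun T :: "(nat set, arrow) path \<Rightarrow> (nat \<Rightarrow>\<^sub>0 nat) \<times> nat set \<Rightarrow> ((nat \<Rightarrow>\<^sub>0 nat) \<times> nat set) \<Rightarrow>\<^sub>0 int" where
  "T (x, p, y) (w, v) =
     (if v = x \<and> good (Poly_Mapping.keys (w + wt (map fst p))) y then frag_of (w + wt (map fst p), y) else 0)"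

definition T_kernel :: "((nat set, arrow) path \<Rightarrow>\<^sub>0 int) set" where
  "T_kernel = {f \<in> frags_on (paths Q). \<forall>t. frag_extend (\<lambda>p. T p t) f = 0}"

lemma ideal_T_kernel: "ideal T_kernel (path_algebra Q)"
  unfolding T_kernel_def
proof (rule representation_kernel_ideal)
  fix p q :: "(nat set, arrow) path" and t :: "(nat \<Rightarrow>\<^sub>0 nat) \<times> nat set"
  assume pq: "p \<in> paths Q" "q \<in> paths Q"
  obtain x p' y x' q' z w v where eq: "p = (x, p', y)" "q = (x', q', z)" "t = (w, v)"
    by (cases p, cases q, cases t) auto
  \<comment> \<open>Goodness for the full support is carried back along \<open>q\<close>, and then
    the lines contributed by \<open>q\<close> are dropped. So \<open>p\<close> cannot kill a vector
    on which the product is nonzero.\<close>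
  have "good (Poly_Mapping.keys (w + wt (map fst p'))) y"
    if g: "good (Poly_Mapping.keys (w + (wt (map fst p') + wt (map fst q')))) z" and "y = x'"
  proof -
    obtain u where u: "oks u x'" "q' = arrows x' u" "z = acts u x'"
      using pq(2) unfolding eq paths_iff by blast
    have "line ` set u \<subseteq> Poly_Mapping.keys (w + (wt (map fst p') + wt (map fst q')))"
      by (auto simp: u keys_add_nat)
    then have "good (Poly_Mapping.keys (w + (wt (map fst p') + wt (map fst q')))) y"
      using g good_acts[OF u(1)] unfolding u(3) \<open>y = x'\<close> by blast
    then show ?thesis by (rule good_mono) (auto simp: keys_add_nat)
  qed
  then show "frag_extend (\<lambda>p. T p t) (path_times p q) = frag_extend (T q) (T p t)"
    by (auto simp: eq add.assoc)
qed

lemma relators_T_kernel: "relators n k \<subseteq> T_kernel"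
proof
  fix r assume r: "r \<in> relators n k"
  have "frag_extend (\<lambda>p. T p t) r = 0" for t
  proof -
    obtain w v where t: "t = (w, v)" by (cases t)
    consider (eq) x p q y where "r = frag_of (x, p, y) - frag_of (x, q, y)" "(map fst p, map fst q) \<in> word_equations"
      | (zero) x p y where "r = frag_of (x, p, y)" "(x, p, y) \<in> paths Q" "map fst p \<in> zero_words"
      | (U) i x where "r = frag_of (x, [(Ulab i, x, x)], x)" "i \<in> {1..n}" "x \<inter> {i - 1, i} = {}"
      using r unfolding relators_def by blast
    then show ?thesis
    proof cases
      case eq
      then show ?thesis by (simp add: t frag_extend_diff word_equations_wt)
    next
      case zero
      obtain u where u: "oks u x" "p = arrows x u" "y = acts u x"
        using zero(2) unfolding paths_iff by blast
      have z: "u \<in> zero_words" using zero(3) u by simp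
      \<comment> \<open>The particle that made two steps leaves two adjacent holes behind, joined by
        the line it crossed first.\<close>
      have "\<not> good S y" if S: "line ` set u \<subseteq> S" for S
      proof -
        consider i where "i \<ge> 1" "u = [Rlab (i - 1), Rlab i]" | i where "i \<ge> 1" "u = [Llab i, Llab (i - 1)]"
          using z by (auto simp: zero_words_def)
        then show ?thesis
        proof cases
          case 1
          then obtain j where j: "i = Suc (Suc j)" using u(1) by (cases i; cases "i - 1") auto
          then have "{j<..Suc j} \<subseteq> S" "j \<notin> y" "Suc j \<notin> y" "Suc j \<le> n"
            using 1 u S by (auto simp: le_Suc_eq)
          then show ?thesis using goodD[of S y j "Suc j"] by auto
        next
          case 2
          then obtain j where j: "i = Suc (Suc j)" using u(1) by (cases i; cases "i - 1") auto
          then have "{Suc j<..Suc (Suc j)} \<subseteq> S" "Suc j \<notin> y" "Suc (Suc j) \<notin> y" "Suc (Suc j) \<le> n"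
            using 2 u S by (auto simp: le_Suc_eq)
          then show ?thesis using goodD[of S y "Suc j" "Suc (Suc j)"] by auto
        qed
      qed
      then show ?thesis by (simp add: t zero(1) u(2) keys_add_nat)
    next
      case U
      have "\<not> good S x" if "i \<in> S" for S
      proof -
        have "{i - 1<..i} = {i}" using U(2) by auto
        then have "{i - 1<..i} \<subseteq> S" using that by simp
        then show ?thesis using goodD[of S x "i - 1" i] U by auto
      qed
      then show ?thesis by (simp add: t U(1) keys_add_nat)
    qed
  qed
  then show "r \<in> T_kernel"
    using relators_paths r by (auto simp: T_kernel_def path_algebra_ops(2))
qed

lemma I_T_kernel: "I \<subseteq> T_kernel"
  unfolding relation_ideal_def
  by (rule ring.genideal_minimal[OF ring_path_algebra ideal_T_kernel relators_T_kernel])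

lemma T_I: "f \<in> I \<Longrightarrow> frag_extend (\<lambda>p. T p t) f = 0"
  using I_T_kernel unfolding T_kernel_def by blast

lemma T_W: "frag_extend (\<lambda>p. T p (w, v)) (W x u) =
  (if x \<in> V \<and> oks u x \<and> v = x \<and> good (Poly_Mapping.keys w \<union> line ` set u) (acts u x)
   then frag_of (w + wt u, acts u x) else 0)"
  by (simp add: W_def keys_add_nat)

section \<open>Supports of nonzero monomials\<close>

lemma card_holes: "x \<in> V \<Longrightarrow> card ({0..n} - x) = n + 1 - k"
  using card_Diff_subset[of x "{0..n}"] V_finite[of x] by (auto simp: Vset_def)

text \<open>Any two holes are separated by a line outside \<open>S\<close>. \<open>g b\<close> is
  the last such line up to the hole \<open>b\<close>; it lies above every earlier hole, so
  \<open>g\<close> is injective on the holes other than the least one. Counting gives n - k \<le> n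
  - |S|.\<close>

lemma good_card:
  assumes "x \<in> V" "good S x" "S \<subseteq> {1..n}"
  shows "card S \<le> k"
proof (cases "{0..n} - x = {}")
  case True
  then have "n + 1 - k = 0" using card_holes[OF assms(1)] by (metis card.empty)
  then show ?thesis using card_mono[OF _ assms(3)] by simp
next
  case False
  define H where "H = {0..n} - x"
  define m where "m = Min H"
  have "finite H" "H \<noteq> {}" using False by (auto simp: H_def)
  then have m: "m \<in> H" "\<And>b. b \<in> H \<Longrightarrow> m \<le> b" by (auto simp: m_def)
  define g where "g b = Max {l \<in> {1..n} - S. l \<le> b}" for b
  have g: "g b \<in> {1..n} - S \<and> a < g b \<and> g b \<le> b" if "a \<in> H" "b \<in> H" "a < b" for a b
  proof -
    have "b \<le> n" "a \<notin> x" "b \<notin> x" using that by (auto simp: H_def)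
    then have "\<not> {a<..b} \<subseteq> S" using goodD[OF assms(2) \<open>a < b\<close>] by blast
    then obtain l where l: "a < l" "l \<le> b" "l \<notin> S" by (meson greaterThanAtMost_iff subsetI)
    then have l': "l \<in> {l \<in> {1..n} - S. l \<le> b}" using that by (auto simp: H_def)
    then have "g b \<in> {l \<in> {1..n} - S. l \<le> b}" unfolding g_def by (intro Max_in) auto
    moreover have "l \<le> g b" using l' unfolding g_def by (intro Max_ge) auto
    ultimately show ?thesis using l by auto
  qed
  have "inj_on g (H - {m})"
  proof (rule linorder_inj_onI)
    fix a b assume "a < b" "a \<in> H - {m}" "b \<in> H - {m}"
    then show "g a \<noteq> g b" using g[of a b] g[of m a] m by force
  qed (rule linear)
  moreover have "g ` (H - {m}) \<subseteq> {1..n} - S"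
  proof (rule image_subsetI)
    fix b assume "b \<in> H - {m}"
    then have "b \<in> H" "m < b" using m(2)[of b] by auto
    then show "g b \<in> {1..n} - S" using g[of m b] m(1) by blast
  qed
  ultimately have "card (H - {m}) \<le> card ({1..n} - S)" by (intro card_inj_on_le) auto
  moreover have "card ({1..n} - S) = n - card S" using assms(3) by (simp add: card_Diff_subset finite_subset)
  moreover have "card S \<le> n" using card_mono[OF _ assms(3)] by simp
  moreover have "card (H - {m}) = n + 1 - k - 1" using card_holes[OF assms(1)] m by (simp add: H_def)
  ultimately show ?thesis by simp
qed

lemma complement_V: "H \<subseteq> {0..n} \<Longrightarrow> card H = n + 1 - k \<Longrightarrow> k \<le> n \<Longrightarrow> {0..n} - H \<in> V"
  by (auto simp: Vset_def card_Diff_subset finite_subset)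

text \<open>Choose n - k lines outside \<open>S\<close> and put a hole immediately to the left of
  each, and one at \<open>n\<close>: every hole but the last is cut off from the later ones by its
  own line. For the end 0 the holes go immediately to the right of the chosen lines.\<close>

lemma ex_good:
  assumes S: "S \<subseteq> {1..n}" "card S \<le> k" and "k \<le> n"
  shows "\<exists>x\<in>V. n \<notin> x \<and> good S x" "\<exists>x\<in>V. 0 \<notin> x \<and> good S x"
proof -
  have "n - k \<le> card ({1..n} - S)"
    using S by (simp add: card_Diff_subset finite_subset)
  then obtain L where L: "L \<subseteq> {1..n} - S" "card L = n - k" "finite L"
    by (metis obtain_subset_with_card_n)
  define H where "H = insert n ((\<lambda>l. l - 1) ` L)"
  have inj: "inj_on (\<lambda>l. l - 1) L"
  proof (rule inj_onI)
    fix a b assume "a \<in> L" "b \<in> L" "a - 1 = b - 1"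
    moreover from this have "1 \<le> a" "1 \<le> b" using L by auto
    ultimately show "a = b" by simp
  qed
  have "l - 1 < n" if "l \<in> L" for l using that L by force
  then have "n \<notin> (\<lambda>l. l - 1) ` L" by auto
  then have "card H = n + 1 - k"
    using L inj \<open>k \<le> n\<close> by (simp add: H_def card_image Suc_diff_le)
  moreover have "H \<subseteq> {0..n}" using L by (force simp: H_def)
  moreover have "good S ({0..n} - H)"
    unfolding good_def
  proof (intro allI impI)
    fix a b assume ab: "a < b" "b \<le> n" "a \<notin> {0..n} - H" "b \<notin> {0..n} - H"
    then obtain l where l: "l \<in> L" "a = l - 1" by (auto simp: H_def)
    then have "l = a + 1" using L by force
    then have "l \<in> {a<..b}" "l \<notin> S" using ab l L by auto
    then show "\<not> {a<..b} \<subseteq> S" by blast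
  qed
  moreover have "n \<notin> {0..n} - H" by (simp add: H_def)
  ultimately show "\<exists>x\<in>V. n \<notin> x \<and> good S x" using complement_V \<open>k \<le> n\<close> by blast
  define K where "K = insert 0 L"
  have "0 \<notin> L" using L by auto
  then have "card K = n + 1 - k" using L \<open>k \<le> n\<close> by (simp add: K_def Suc_diff_le)
  moreover have "K \<subseteq> {0..n}" using L by (force simp: K_def)
  moreover have "good S ({0..n} - K)"
    unfolding good_def
  proof (intro allI impI)
    fix a b assume ab: "a < b" "b \<le> n" "a \<notin> {0..n} - K" "b \<notin> {0..n} - K"
    then have "b \<in> L" by (auto simp: K_def)
    then show "\<not> {a<..b} \<subseteq> S" using L ab by auto
  qed
  moreover have "0 \<notin> {0..n} - K" by (simp add: K_def)
  ultimately show "\<exists>x\<in>V. 0 \<notin> x \<and> good S x" using complement_V \<open>k \<le> n\<close> by blast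
qed

section \<open>Connecting the good states by admissible moves\<close>

lemma holes_not_psubset: "x \<in> V \<Longrightarrow> y \<in> V \<Longrightarrow> \<not> {0..n} - y \<subset> {0..n} - x"
  using psubset_card_mono[of "{0..n} - x" "{0..n} - y"] card_holes by auto

text \<open>Let \<open>d\<close> be the first position where two good states differ, a hole of \<open>x\<close>. The first hole
  of \<open>y\<close> beyond \<open>d\<close> can be moved left: its new component would otherwise contain two
  holes of \<open>x\<close>.\<close>

lemma good_hole_left:
  assumes V: "x \<in> V" "y \<in> V" and n: "n \<notin> x" "n \<notin> y" and good: "good S x" "good S y"
    and d: "d \<notin> x" "d \<in> y" "\<And>j. j < d \<Longrightarrow> j \<in> x \<longleftrightarrow> j \<in> y"
  shows "\<exists>f<n. ok (Rlab f) y \<and> good (insert f S) y"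
proof -
  have dn: "d < n" using V(2) d(2) n(2) by (auto simp: Vset_def le_less)
  define f where "f = (LEAST f. d < f \<and> f \<notin> y)"
  have f: "d < f \<and> f \<notin> y" unfolding f_def by (rule LeastI[where k = n]) (use dn n(2) in simp)
  have below: "j \<in> y" if "d \<le> j" "j < f" for j
    using that not_less_Least[of j "\<lambda>f. d < f \<and> f \<notin> y"] d(2) by (auto simp: f_def le_less)
  \<comment> \<open>Otherwise every hole of \<open>y\<close> is a hole of \<open>x\<close> and
    \<open>d\<close> is one more, although both states have equally many holes. Staying below
    \<open>n\<close> leaves the hole at the end in place.\<close>
  have "f \<noteq> n"
  proof
    assume "f = n"
    have "a \<notin> x \<and> a \<noteq> d" if a: "a \<in> {0..n} - y" for a
    proof (cases "a < d")
      case True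
      then show ?thesis using a d(3) by auto
    next
      case False
      then have "\<not> a < f" using below[of a] a by auto
      then show ?thesis using a \<open>f = n\<close> n(1) dn by auto
    qed
    then have "{0..n} - y \<subset> {0..n} - x" using d dn by auto
    then show False using holes_not_psubset[OF V] by blast
  qed
  moreover have "f \<le> n" unfolding f_def by (rule Least_le) (use dn n(2) in simp)
  moreover have "f - 1 \<in> y" using f by (intro below) auto
  moreover have "good (insert f S) y"
    unfolding good_def
  proof (intro allI impI notI)
    fix a b assume ab: "a < b" "b \<le> n" "a \<notin> y" "b \<notin> y" and sub: "{a<..b} \<subseteq> insert f S"
    have "f \<in> {a<..b}" using goodD[OF good(2) ab] sub by blast
    then have "a < d" using below[of a] ab(3) by force
    moreover have "{a<..d} \<subseteq> S"
    proof
      fix j assume "j \<in> {a<..d}"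
      then have "j \<in> {a<..b}" "j \<noteq> f" using f \<open>f \<in> {a<..b}\<close> by auto
      then show "j \<in> S" using sub by blast
    qed
    ultimately show False using goodD[OF good(1), of a d] d ab dn by auto
  qed
  ultimately show ?thesis using f by (intro exI[of _ f]) auto
qed

text \<open>Mirror image of \<open>good_hole_left\<close>, with the last difference \<open>d\<close>
  and the last hole of \<open>y\<close> before it. The witness is the line to the right of that
  hole, hence \<open>Suc f\<close>; the bound \<open>f > 1\<close> in the conclusion leaves the hole
  at 0 in place.\<close>

lemma good_hole_right:
  assumes V: "x \<in> V" "y \<in> V" and n: "0 \<notin> x" "0 \<notin> y" and good: "good S x" "good S y"
    and d: "d \<notin> x" "d \<in> y" "\<And>j. d < j \<Longrightarrow> j \<in> x \<longleftrightarrow> j \<in> y"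
  shows "\<exists>f>1. ok (Llab f) y \<and> good (insert f S) y"
proof -
  have dn: "0 < d" "d \<le> n" using V(2) d(2) n(2) by (auto simp: Vset_def intro: gr0I)
  define f where "f = Max {f. f < d \<and> f \<notin> y}"
  have fin: "finite {f. f < d \<and> f \<notin> y}" by simp
  have "f \<in> {f. f < d \<and> f \<notin> y}" unfolding f_def using dn n(2) by (intro Max_in fin) auto
  then have f: "f < d" "f \<notin> y" by auto
  have above: "j \<in> y" if "j \<le> d" "f < j" for j
    using that Max_ge[OF fin, of j] d(2) by (force simp: f_def le_less)
  have "f \<noteq> 0"
  proof
    assume "f = 0"
    have "a \<notin> x \<and> a \<noteq> d" if a: "a \<in> {0..n} - y" for a
    proof (cases "d < a")
      case True
      then show ?thesis using a d(3) by auto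
    next
      case False
      then have "\<not> f < a" using above[of a] a by auto
      then show ?thesis using a \<open>f = 0\<close> n(1) dn by auto
    qed
    then have "{0..n} - y \<subset> {0..n} - x" using d dn by auto
    then show False using holes_not_psubset[OF V] by blast
  qed
  moreover have "Suc f \<in> y" using f by (intro above) auto
  moreover have "good (insert (Suc f) S) y"
    unfolding good_def
  proof (intro allI impI notI)
    fix a b assume ab: "a < b" "b \<le> n" "a \<notin> y" "b \<notin> y" and sub: "{a<..b} \<subseteq> insert (Suc f) S"
    have "Suc f \<in> {a<..b}" using goodD[OF good(2) ab] sub by blast
    then have "d < b" using above[of b] ab(4) by force
    moreover have "{d<..b} \<subseteq> S"
    proof
      fix j assume "j \<in> {d<..b}"
      then have "j \<in> {a<..b}" "j \<noteq> Suc f" using f \<open>Suc f \<in> {a<..b}\<close> by auto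
      then show "j \<in> S" using sub by blast
    qed
    ultimately show False using goodD[OF good(1), of d b] d ab dn by auto
  qed
  ultimately show ?thesis using f dn by (intro exI[of _ "Suc f"]) auto
qed

text \<open>No common minimal element has to be named: as long as two elements differ, one of them
  is replaced by a smaller one with the same value of \<open>c\<close>.\<close>

lemma connected_by_descent:
  fixes \<mu> :: "'s \<Rightarrow> nat" and c :: "'s \<Rightarrow> 'c"
  assumes descent: "\<And>x y. x \<in> G \<Longrightarrow> y \<in> G \<Longrightarrow> x \<noteq> y \<Longrightarrow>
      (\<exists>z\<in>G. c z = c x \<and> \<mu> z < \<mu> x) \<or> (\<exists>z\<in>G. c z = c y \<and> \<mu> z < \<mu> y)"
  shows "x \<in> G \<Longrightarrow> y \<in> G \<Longrightarrow> c x = c y"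
proof (induction "\<mu> x + \<mu> y" arbitrary: x y rule: less_induct)
  case less
  show ?case
  proof (cases "x = y")
    case False
    from descent[OF less.prems False] show ?thesis
    proof
      assume "\<exists>z\<in>G. c z = c x \<and> \<mu> z < \<mu> x"
      then obtain z where "z \<in> G" "c z = c x" "\<mu> z < \<mu> x" by blast
      then show ?thesis using less.hyps[of z y] less.prems by simp
    next
      assume "\<exists>z\<in>G. c z = c y \<and> \<mu> z < \<mu> y"
      then obtain z where "z \<in> G" "c z = c y" "\<mu> z < \<mu> y" by blast
      then show ?thesis using less.hyps[of x z] less.prems by simp
    qed
  qed simp
qed

lemma sum_insert_Diff:
  fixes A :: "nat set"
  assumes "finite A" "a \<in> A" "b \<notin> A"
  shows "\<Sum>(insert b (A - {a})) + a = \<Sum>A + b"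
proof -
  have "\<Sum>A = a + \<Sum>(A - {a})" using assms by (simp add: sum.remove)
  moreover have "\<Sum>(insert b (A - {a})) = b + \<Sum>(A - {a})" using assms by simp
  ultimately show ?thesis by simp
qed

text \<open>Here \<open>c\<close> stands for a coefficient of which only the invariance under
  admissible moves is known. For \<open>e = n\<close> holes travel left and the sum of their
  positions drops; for \<open>e = 0\<close> holes travel right, so it is the sum of the particle
  positions that drops.\<close>

lemma good_connected:
  fixes c :: "nat set \<Rightarrow> 'c"
  assumes e: "e = 0 \<or> e = n"
    and step: "\<And>x l. x \<in> V \<Longrightarrow> is_move l \<Longrightarrow> ok l x \<Longrightarrow> e \<notin> x \<Longrightarrow> e \<notin> act l x \<Longrightarrow> good (insert (line l) S) x
      \<Longrightarrow> c (act l x) = c x"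
    and xy: "x \<in> V" "e \<notin> x" "good S x" "y \<in> V" "e \<notin> y" "good S y"
  shows "c x = c y"
proof -
  define G where "G = {x \<in> V. e \<notin> x \<and> good S x}"
  have next_state: "act l x \<in> G \<and> c (act l x) = c x"
    if "x \<in> G" "is_move l" "ok l x" "e \<notin> act l x" "good (insert (line l) S) x" for x l
  proof -
    \<comment> \<open>The move stays inside a block of the enlarged set, so goodness survives it;
      the extra line is dropped afterwards.\<close>
    have "good (insert (line l) S) (act l x)" using that good_act by blast
    then show ?thesis using that step[of x l] act_V[of x l] by (auto simp: G_def intro: good_mono)
  qed
  have "x \<in> G" "y \<in> G" using xy by (auto simp: G_def)
  from e show ?thesis
  proof
    assume e: "e = n"
    have half: "\<exists>z\<in>G. c z = c y \<and> \<Sum>({0..n} - z) < \<Sum>({0..n} - y)"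
      if G: "x \<in> G" "y \<in> G" and d: "d \<notin> x" "d \<in> y" "\<And>j. j < d \<Longrightarrow> j \<in> x \<longleftrightarrow> j \<in> y" for x y d
    proof -
      obtain f where f: "f < n" "ok (Rlab f) y" "good (insert f S) y"
        using good_hole_left[of x y S d] G d by (auto simp: G_def e)
      then have z: "act (Rlab f) y \<in> G \<and> c (act (Rlab f) y) = c y"
        using G by (intro next_state) (auto simp: G_def e)
      have "{0..n} - act (Rlab f) y = insert (f - 1) (({0..n} - y) - {f})"
        using f by auto
      moreover have "\<Sum>(insert (f - 1) (({0..n} - y) - {f})) + f = \<Sum>({0..n} - y) + (f - 1)"
        using f by (intro sum_insert_Diff) auto
      ultimately have "\<Sum>({0..n} - act (Rlab f) y) + f = \<Sum>({0..n} - y) + (f - 1)"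
        by (simp only:)
      moreover have "1 \<le> f" using f by simp
      ultimately have "\<Sum>({0..n} - act (Rlab f) y) < \<Sum>({0..n} - y)"
        by linarith
      then show ?thesis using z by blast
    qed
    show ?thesis
    proof (rule connected_by_descent[OF _ \<open>x \<in> G\<close> \<open>y \<in> G\<close>, of c "\<lambda>z. \<Sum>({0..n} - z)"])
      fix x y assume G: "x \<in> G" "y \<in> G" "x \<noteq> y"
      define d where "d = (LEAST j. (j \<in> x) \<noteq> (j \<in> y))"
      have "\<exists>j. (j \<in> x) \<noteq> (j \<in> y)" using G by blast
      then have "(d \<in> x) \<noteq> (d \<in> y)" unfolding d_def by (rule LeastI_ex)
      moreover have "(j \<in> x) = (j \<in> y)" if "j < d" for j
        using not_less_Least[of j "\<lambda>j. (j \<in> x) \<noteq> (j \<in> y)"] that unfolding d_def by blast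
      \<comment> \<open>The state that is occupied at \<open>d\<close> is the one to be
        moved.\<close>
      ultimately show "(\<exists>z\<in>G. c z = c x \<and> \<Sum>({0..n} - z) < \<Sum>({0..n} - x)) \<or>
          (\<exists>z\<in>G. c z = c y \<and> \<Sum>({0..n} - z) < \<Sum>({0..n} - y))"
        using half[of x y d] half[of y x d] G by blast
    qed
  next
    assume e: "e = 0"
    have half: "\<exists>z\<in>G. c z = c y \<and> \<Sum>z < \<Sum>y"
      if G: "x \<in> G" "y \<in> G" and d: "d \<notin> x" "d \<in> y" "\<And>j. d < j \<Longrightarrow> j \<in> x \<longleftrightarrow> j \<in> y" for x y d
    proof -
      obtain f where f: "1 < f" "ok (Llab f) y" "good (insert f S) y"
        using good_hole_right[of x y S d] G d by (auto simp: G_def e)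
      then have z: "act (Llab f) y \<in> G \<and> c (act (Llab f) y) = c y"
        using G by (intro next_state) (auto simp: G_def e)
      have "finite y" using G V_finite by (auto simp: G_def)
      then have "\<Sum>(insert (f - 1) (y - {f})) + f = \<Sum>y + (f - 1)"
        using f by (intro sum_insert_Diff) auto
      then have "\<Sum>(act (Llab f) y) < \<Sum>y"
        using f(1) unfolding act.simps by linarith
      then show ?thesis using z by blast
    qed
    show ?thesis
    proof (rule connected_by_descent[OF _ \<open>x \<in> G\<close> \<open>y \<in> G\<close>, of c "\<lambda>z. \<Sum>z"])
      fix x y assume G: "x \<in> G" "y \<in> G" "x \<noteq> y"
      define D where "D = {j. (j \<in> x) \<noteq> (j \<in> y)}"
      define d where "d = Max D"
      have "finite x" "finite y" using G V_finite by (auto simp: G_def)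
      then have fin: "finite D" by (intro finite_subset[of D "x \<union> y"]) (auto simp: D_def)
      have "D \<noteq> {}" using G by (auto simp: D_def)
      then have "d \<in> D" unfolding d_def using fin by simp
      then have "(d \<in> x) \<noteq> (d \<in> y)" by (simp add: D_def)
      moreover have "(j \<in> x) = (j \<in> y)" if "d < j" for j
      proof -
        have "j \<notin> D" using that Max_ge[OF fin, of j] unfolding d_def by (meson not_less)
        then show ?thesis by (simp add: D_def)
      qed
      ultimately show "(\<exists>z\<in>G. c z = c x \<and> \<Sum>z < \<Sum>x) \<or> (\<exists>z\<in>G. c z = c y \<and> \<Sum>z < \<Sum>y)"
        using half[of x y d] half[of y x d] G by blast
    qed
  qed
qed

end

section \<open>The truncated algebras\<close>

context strands
begin

definition \<pi> :: "((nat set, arrow) path \<Rightarrow>\<^sub>0 int) \<Rightarrow> ((nat set, arrow) path \<Rightarrow>\<^sub>0 int) set" where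
  "\<pi> f = I +>\<^bsub>path_algebra Q\<^esub> f"

lemma \<pi>_image: "\<pi> f = (\<lambda>h. h + f) ` I"
  by (auto simp: \<pi>_def a_r_coset_def' path_algebra_ops)

lemma \<pi>_eq_iff: "\<pi> f = \<pi> g \<longleftrightarrow> f - g \<in> I"
proof
  assume "\<pi> f = \<pi> g"
  moreover have "f \<in> \<pi> f" unfolding \<pi>_image by (rule image_eqI[of _ _ 0]) auto
  ultimately obtain h where "h \<in> I" "f = h + g" unfolding \<pi>_image by blast
  then show "f - g \<in> I" by simp
next
  have sub: "\<pi> f \<subseteq> \<pi> g" if "f - g \<in> I" for f g
    unfolding \<pi>_image
  proof (rule image_subsetI)
    fix h assume "h \<in> I"
    then have "h + (f - g) \<in> I" using that by (rule I_add)
    moreover have "h + f = (h + (f - g)) + g" by simp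
    ultimately show "h + f \<in> (\<lambda>h. h + g) ` I" by blast
  qed
  assume "f - g \<in> I"
  moreover from this have "g - f \<in> I" using I_minus by fastforce
  ultimately show "\<pi> f = \<pi> g" using sub by blast
qed

lemma \<pi>_ring_hom: "\<pi> \<in> ring_hom (path_algebra Q) (Balg n k)"
  using ideal.rcos_ring_hom[OF I_ideal] unfolding \<pi>_def[abs_def] Balg_def by simp

lemma Balg_ring: "ring (Balg n k)"
  unfolding Balg_def by (rule ideal.quotient_is_ring[OF I_ideal])

lemma \<pi>_mult: "f \<in> frags_on (paths Q) \<Longrightarrow> g \<in> frags_on (paths Q) \<Longrightarrow> \<pi> f \<otimes>\<^bsub>Balg n k\<^esub> \<pi> g = \<pi> (f \<odot> g)"
  using ring_hom_mult[OF \<pi>_ring_hom, of f g] by (simp add: path_algebra_ops)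

lemma \<pi>_add: "f \<in> frags_on (paths Q) \<Longrightarrow> g \<in> frags_on (paths Q) \<Longrightarrow> \<pi> f \<oplus>\<^bsub>Balg n k\<^esub> \<pi> g = \<pi> (f + g)"
  using ring_hom_add[OF \<pi>_ring_hom, of f g] by (simp add: path_algebra_ops)

lemma \<pi>_0: "\<zero>\<^bsub>Balg n k\<^esub> = \<pi> 0"
  by (simp add: Balg_def FactRing_def \<pi>_image)

lemma carrier_Balg: "carrier (Balg n k) = \<pi> ` frags_on (paths Q)"
  by (auto simp: Balg_def FactRing_def A_RCOSETS_def' \<pi>_def path_algebra_ops)

lemma \<pi>_sum:
  assumes "finite A" "\<And>a. a \<in> A \<Longrightarrow> f a \<in> frags_on (paths Q)"
  shows "(\<Oplus>\<^bsub>Balg n k\<^esub>a\<in>A. \<pi> (f a)) = \<pi> (sum f A)"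
  using assms
proof (induction A rule: finite_induct)
  case empty
  interpret ring "Balg n k" by (rule Balg_ring)
  show ?case by (simp add: \<pi>_0)
next
  case (insert a A)
  interpret ring "Balg n k" by (rule Balg_ring)
  have "(\<lambda>a. \<pi> (f a)) \<in> A \<rightarrow> carrier (Balg n k)" "\<pi> (f a) \<in> carrier (Balg n k)"
    using insert.prems unfolding carrier_Balg by blast+
  then have "(\<Oplus>\<^bsub>Balg n k\<^esub>a\<in>insert a A. \<pi> (f a)) = \<pi> (f a) \<oplus>\<^bsub>Balg n k\<^esub> \<pi> (sum f A)"
    using insert by simp
  also have "\<dots> = \<pi> (f a + sum f A)"
    using insert.prems by (intro \<pi>_add) (simp_all add: keys_sum_subset)
  finally show ?case using insert by simp
qed

lemma idem_at_W: "x \<in> V \<Longrightarrow> idem_at n k x = \<pi> (W x [])"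
  by (simp add: idem_at_def B_class_def \<pi>_def W_def)

lemma U_at_W: "x \<in> V \<Longrightarrow> i \<in> {1..n} \<Longrightarrow> U_at n k i x = \<pi> (W x [Ulab i])"
  by (simp add: U_at_def B_class_def \<pi>_def W_def)

lemma W_sandwich:
  "x \<in> V \<Longrightarrow> y \<in> V \<Longrightarrow> W x [] \<odot> frag_of (u, p, v) \<odot> W y [] = (if u = x \<and> v = y then frag_of (u, p, v) else 0)"
  by (simp add: W_def path_mult_frag_of)

end

text \<open>The truncations \<open>B\<^sub>l\<close> and \<open>B\<^sub>r\<close> keep the states that have a hole at the end \<open>e\<close>,
  which is \<open>n\<close> or \<open>0\<close>, respectively.\<close>

locale end_truncation = strands n k for n k +
  fixes e :: nat
  assumes k_le: "k \<le> n" and e_end: "e = 0 \<or> e = n"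
begin

definition X :: "nat set set" where "X = {x \<in> V. e \<notin> x}"

abbreviation "B \<equiv> idem_truncation (Balg n k) (idem_at n k) X"

definition pathsX :: "(nat set, arrow) path set" where
  "pathsX = {(u, p, v). (u, p, v) \<in> paths Q \<and> u \<in> X \<and> v \<in> X}"

text \<open>Representatives of the truncation inside the path algebra. Only the ends of a path must
  lie in \<open>X\<close>; it may pass through other states. Computations in \<open>B\<close> become
  computations here modulo \<open>I\<close>.\<close>

definition AX :: "((nat set, arrow) path \<Rightarrow>\<^sub>0 int) set" where "AX = frags_on pathsX"

lemma AX_closed:
  "0 \<in> AX" "f \<in> AX \<Longrightarrow> - f \<in> AX"
  "f \<in> AX \<Longrightarrow> g \<in> AX \<Longrightarrow> f + g \<in> AX" "f \<in> AX \<Longrightarrow> g \<in> AX \<Longrightarrow> f - g \<in> AX"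
  by (simp_all add: AX_def keys_plus_subset keys_diff_subset)

lemma AX_sum: "(\<And>i. i \<in> A \<Longrightarrow> f i \<in> AX) \<Longrightarrow> sum f A \<in> AX"
  by (simp add: AX_def keys_sum_subset)

lemma AX_induct [consumes 1, case_names zero path diff]:
  assumes "f \<in> AX" "P 0"
    and "\<And>x w. x \<in> X \<Longrightarrow> oks w x \<Longrightarrow> acts w x \<in> X \<Longrightarrow> P (W x w)"
    and "\<And>a b. P a \<Longrightarrow> P b \<Longrightarrow> P (a - b)"
  shows "P f"
proof -
  have frag: "P (frag_of q)" if mem: "q \<in> pathsX" for q
  proof -
    obtain x p y where q: "q = (x, p, y)" "x \<in> X" "y \<in> X" "(x, p, y) \<in> paths Q"
      using mem by (auto simp: pathsX_def)
    then obtain w where "x \<in> V" "oks w x" "p = arrows x w" "y = acts w x"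
      unfolding paths_iff by blast
    then show ?thesis using q assms(3)[of x w] by (simp add: W_def)
  qed
  have sub: "Poly_Mapping.keys f \<subseteq> pathsX" using assms(1) by (simp add: AX_def)
  show ?thesis by (rule frag_induction[where P = P, OF sub]) (fact assms(2) frag assms(4))+
qed

lemma X_V: "x \<in> X \<Longrightarrow> x \<in> V"
  by (simp add: X_def)

lemma finite_X: "finite X"
  using finite_V by (simp add: X_def)

lemma AX_paths: "f \<in> AX \<Longrightarrow> f \<in> frags_on (paths Q)"
  unfolding AX_def mem_Collect_eq by (erule order_trans) (auto simp: pathsX_def)

lemma W_AX: "x \<in> X \<Longrightarrow> acts w x \<in> X \<Longrightarrow> W x w \<in> AX"
  using W_paths[of x w] by (auto simp: W_def pathsX_def AX_def)

lemma sandwich_pathsX: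
  assumes "x \<in> X" "y \<in> X" "f \<in> frags_on (paths Q)"
  shows "W x [] \<odot> f \<odot> W y [] \<in> frags_on {(u, p, v). (u, p, v) \<in> paths Q \<and> u = x \<and> v = y}"
  using assms(3) unfolding mem_Collect_eq
proof (induction f rule: frag_induction)
  case (one q)
  then show ?case using assms X_V by (cases q) (auto simp: W_sandwich)
qed (simp_all add: path_mult_diff keys_diff_subset)

lemma sum_sandwich:
  assumes "f \<in> AX"
  shows "(\<Sum>z\<in>X \<times> X. W (fst z) [] \<odot> f \<odot> W (snd z) []) = f"
  using assms
proof (induction f rule: AX_induct)
  case (path x w)
  have "(\<Sum>z\<in>X \<times> X. W (fst z) [] \<odot> W x w \<odot> W (snd z) []) = (\<Sum>z\<in>X \<times> X. if z = (x, acts w x) then W x w else 0)"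
  proof (rule sum.cong[OF refl])
    fix z assume "z \<in> X \<times> X"
    obtain a b where z: "z = (a, b)" by (cases z)
    show "W (fst z) [] \<odot> W x w \<odot> W (snd z) [] = (if z = (x, acts w x) then W x w else 0)"
      unfolding z by (cases "x = a"; cases "b = acts w x") (simp_all add: W_mult)
  qed
  then show ?case using path finite_X by (simp add: sum.delta)
qed (simp_all add: path_mult_diff sum_subtractf)

text \<open>Sandwiching between two idempotents projects a representative onto its paths from one
  state to the other, and over \<open>X\<close> these projections add up to an element of
  \<open>AX\<close>.\<close>

lemma carrier_B: "carrier B = \<pi> ` AX"
proof -
  have eq: "(\<Oplus>\<^bsub>Balg n k\<^esub>z\<in>X \<times> X. idem_at n k (fst z) \<otimes>\<^bsub>Balg n k\<^esub> b z \<otimes>\<^bsub>Balg n k\<^esub> idem_at n k (snd z))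
    = \<pi> (\<Sum>z\<in>X \<times> X. W (fst z) [] \<odot> f z \<odot> W (snd z) [])"
    if f: "\<And>z. z \<in> X \<times> X \<Longrightarrow> f z \<in> frags_on (paths Q) \<and> b z = \<pi> (f z)" for b f
  proof -
    interpret ring "Balg n k" by (rule Balg_ring)
    have f': "W (fst z) [] \<odot> f z \<odot> W (snd z) [] \<in> frags_on (paths Q)" if "z \<in> X \<times> X" for z
      using f[OF that] by (intro path_mult_closed W_paths) blast
    have "idem_at n k (fst z) \<otimes>\<^bsub>Balg n k\<^esub> b z \<otimes>\<^bsub>Balg n k\<^esub> idem_at n k (snd z) = \<pi> (W (fst z) [] \<odot> f z \<odot> W (snd z) [])"
      if z: "z \<in> X \<times> X" for z
    proof -
      have fz: "f z \<in> frags_on (paths Q)" "b z = \<pi> (f z)" and V: "fst z \<in> V" "snd z \<in> V"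
        using f[OF z] z X_V by auto
      show ?thesis
        unfolding fz(2) idem_at_W[OF V(1)] idem_at_W[OF V(2)]
          \<pi>_mult[OF W_paths fz(1)] \<pi>_mult[OF path_mult_closed[OF W_paths fz(1)] W_paths] ..
    qed
    then have "(\<Oplus>\<^bsub>Balg n k\<^esub>z\<in>X \<times> X. idem_at n k (fst z) \<otimes>\<^bsub>Balg n k\<^esub> b z \<otimes>\<^bsub>Balg n k\<^esub> idem_at n k (snd z))
      = (\<Oplus>\<^bsub>Balg n k\<^esub>z\<in>X \<times> X. \<pi> (W (fst z) [] \<odot> f z \<odot> W (snd z) []))"
      using f' unfolding carrier_Balg by (intro finsum_cong') (auto simp: carrier_Balg)
    also have "\<dots> = \<pi> (\<Sum>z\<in>X \<times> X. W (fst z) [] \<odot> f z \<odot> W (snd z) [])"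
      using f' finite_X by (intro \<pi>_sum) blast+
    finally show ?thesis .
  qed
  show ?thesis
  proof (intro equalityI subsetI)
    fix a assume "a \<in> carrier B"
    then obtain b where b: "b \<in> X \<times> X \<rightarrow> carrier (Balg n k)"
      and a: "a = (\<Oplus>\<^bsub>Balg n k\<^esub>z\<in>X \<times> X. idem_at n k (fst z) \<otimes>\<^bsub>Balg n k\<^esub> b z \<otimes>\<^bsub>Balg n k\<^esub> idem_at n k (snd z))"
      by (auto simp: idem_truncation_def)
    have "\<forall>z\<in>X \<times> X. \<exists>f. f \<in> frags_on (paths Q) \<and> b z = \<pi> f"
      using b unfolding carrier_Balg by blast
    then obtain f where f: "\<And>z. z \<in> X \<times> X \<Longrightarrow> f z \<in> frags_on (paths Q) \<and> b z = \<pi> (f z)"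
      by metis
    have "W (fst z) [] \<odot> f z \<odot> W (snd z) [] \<in> AX" if "z \<in> X \<times> X" for z
    proof -
      have "{(u, p, v). (u, p, v) \<in> paths Q \<and> u = fst z \<and> v = snd z} \<subseteq> pathsX"
        using that by (auto simp: pathsX_def)
      then show ?thesis
        using sandwich_pathsX[of "fst z" "snd z" "f z"] f[OF that] that unfolding AX_def by fastforce
    qed
    then have "(\<Sum>z\<in>X \<times> X. W (fst z) [] \<odot> f z \<odot> W (snd z) []) \<in> AX"
      by (rule AX_sum)
    moreover have "a = \<pi> (\<Sum>z\<in>X \<times> X. W (fst z) [] \<odot> f z \<odot> W (snd z) [])"
      unfolding a by (rule eq) (rule f)
    ultimately show "a \<in> \<pi> ` AX" by blast
  next
    fix a assume "a \<in> \<pi> ` AX"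
    then obtain f where f: "f \<in> AX" "a = \<pi> f" by blast
    have f': "f \<in> frags_on (paths Q)" using f(1) by (rule AX_paths)
    then have "\<pi> f \<in> carrier (Balg n k)" unfolding carrier_Balg by (rule imageI)
    \<comment> \<open>The same element may be used in every corner, since the idempotents cut out
      the part belonging to that corner.\<close>
    moreover have "a = (\<Oplus>\<^bsub>Balg n k\<^esub>z\<in>X \<times> X. idem_at n k (fst z) \<otimes>\<^bsub>Balg n k\<^esub> \<pi> f \<otimes>\<^bsub>Balg n k\<^esub> idem_at n k (snd z))"
      using eq[of "\<lambda>_. f" "\<lambda>_. \<pi> f"] f' by (simp add: sum_sandwich[OF f(1)] f(2))
    ultimately show "a \<in> carrier B"
      by (auto simp: idem_truncation_def intro!: exI[of _ "\<lambda>_. \<pi> f"])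
  qed
qed

section \<open>Ring operations of the truncation on representatives\<close>

definition E :: "(nat set, arrow) path \<Rightarrow>\<^sub>0 int" where "E = (\<Sum>x\<in>X. W x [])"

lemma E_AX: "E \<in> AX"
  unfolding E_def by (intro AX_sum W_AX) simp_all

lemma E_mult: "f \<in> AX \<Longrightarrow> E \<odot> f = f" "f \<in> AX \<Longrightarrow> f \<odot> E = f"
  by (induction f rule: AX_induct)
    (simp_all add: E_def path_mult_diff path_mult_sum_left path_mult_sum_right W_mult finite_X
      sum_subtractf sum.delta sum.delta')

lemma path_mult_AX:
  assumes "f \<in> AX" "g \<in> AX"
  shows "f \<odot> g \<in> AX"
  using assms(1)
proof (induction f rule: AX_induct)
  case (path x w)
  show ?case using assms(2)
  proof (induction g rule: AX_induct)
    case (path y u)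
    then show ?case
      using W_AX[of x "w @ u"] \<open>x \<in> X\<close> by (auto simp: W_mult AX_closed)
  qed (simp_all add: path_mult_diff AX_closed)
qed (simp_all add: path_mult_diff AX_closed)

lemma B_ops:
  "f \<in> AX \<Longrightarrow> g \<in> AX \<Longrightarrow> \<pi> f \<otimes>\<^bsub>B\<^esub> \<pi> g = \<pi> (f \<odot> g)"
  "f \<in> AX \<Longrightarrow> g \<in> AX \<Longrightarrow> \<pi> f \<oplus>\<^bsub>B\<^esub> \<pi> g = \<pi> (f + g)"
  "\<zero>\<^bsub>B\<^esub> = \<pi> 0"
proof -
  assume fg: "f \<in> AX" "g \<in> AX"
  note fg' = fg[THEN AX_paths]
  show "\<pi> f \<otimes>\<^bsub>B\<^esub> \<pi> g = \<pi> (f \<odot> g)" "\<pi> f \<oplus>\<^bsub>B\<^esub> \<pi> g = \<pi> (f + g)"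
    using \<pi>_mult[OF fg'] \<pi>_add[OF fg'] by (simp_all add: idem_truncation_def)
next
  show "\<zero>\<^bsub>B\<^esub> = \<pi> 0" by (simp add: idem_truncation_def \<pi>_0)
qed

lemma B_one: "\<one>\<^bsub>B\<^esub> = \<pi> E"
proof -
  interpret ring "Balg n k" by (rule Balg_ring)
  have "(\<Oplus>\<^bsub>Balg n k\<^esub>x\<in>X. idem_at n k x) = (\<Oplus>\<^bsub>Balg n k\<^esub>x\<in>X. \<pi> (W x []))"
    using W_paths X_V by (intro finsum_cong') (auto simp: idem_at_W carrier_Balg)
  also have "\<dots> = \<pi> E"
    unfolding E_def by (rule \<pi>_sum[OF finite_X W_paths])
  finally show ?thesis by (simp add: idem_truncation_def)
qed

lemma B_ring: "ring B"
proof (rule ringI)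
  show "abelian_group B"
  proof (rule abelian_groupI)
    fix a assume "a \<in> carrier B"
    then obtain f where f: "f \<in> AX" "a = \<pi> f" unfolding carrier_B by blast
    have "\<pi> (- f) \<oplus>\<^bsub>B\<^esub> a = \<zero>\<^bsub>B\<^esub>"
      using f by (simp add: B_ops AX_closed)
    then show "\<exists>b\<in>carrier B. b \<oplus>\<^bsub>B\<^esub> a = \<zero>\<^bsub>B\<^esub>"
      unfolding carrier_B using AX_closed(2)[OF f(1)] by blast
  qed (auto simp: carrier_B B_ops AX_closed ac_simps)
  show "monoid B"
    by (rule monoidI)
      (auto simp: carrier_B B_ops B_one E_mult E_AX path_mult_AX path_mult_assoc)
qed (auto simp: carrier_B B_ops AX_closed path_mult_AX path_mult_add)

lemma \<pi>_sum_B: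
  assumes "finite A" "\<And>a. a \<in> A \<Longrightarrow> f a \<in> AX"
  shows "(\<Oplus>\<^bsub>B\<^esub>a\<in>A. \<pi> (f a)) = \<pi> (sum f A)"
  using assms
proof (induction A rule: finite_induct)
  case empty
  interpret ring B by (rule B_ring)
  show ?case by (simp add: B_ops)
next
  case (insert a A)
  interpret ring B by (rule B_ring)
  have "(\<lambda>a. \<pi> (f a)) \<in> A \<rightarrow> carrier B" "\<pi> (f a) \<in> carrier B"
    using insert.prems unfolding carrier_B by blast+
  then have "(\<Oplus>\<^bsub>B\<^esub>a\<in>insert a A. \<pi> (f a)) = \<pi> (f a) \<oplus>\<^bsub>B\<^esub> \<pi> (sum f A)"
    using insert by simp
  also have "\<dots> = \<pi> (f a + sum f A)"
    using insert.prems by (intro B_ops AX_sum) simp_all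
  finally show ?case using insert by simp
qed

lemma carrier_center_B:
  "carrier (ring_center B) = \<pi> ` {f \<in> AX. \<forall>g\<in>AX. f \<odot> g - g \<odot> f \<in> I}"
proof -
  have "\<pi> f \<otimes>\<^bsub>B\<^esub> \<pi> g = \<pi> g \<otimes>\<^bsub>B\<^esub> \<pi> f \<longleftrightarrow> f \<odot> g - g \<odot> f \<in> I"
    if "f \<in> AX" "g \<in> AX" for f g
    by (simp only: B_ops(1)[OF that] B_ops(1)[OF that(2,1)] \<pi>_eq_iff)
  then show ?thesis
    unfolding ring_center_def carrier_B by auto
qed

end

section \<open>Monomials\<close>

lemma lookup_frag_extend:
  "Poly_Mapping.lookup (frag_extend F c) t = (\<Sum>m\<in>Poly_Mapping.keys c. Poly_Mapping.lookup c m * Poly_Mapping.lookup (F m) t)"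
  by (simp add: frag_extend_def lookup_sum)

lemma frag_extend_frag_extend:
  "frag_extend F (frag_extend G c) = frag_extend (\<lambda>m. frag_extend F (G m)) c"
  by (induction c rule: frag_induction[OF subset_UNIV]) (simp_all add: frag_extend_diff)

lemma double_eq_iff: "m + m = m' + m' \<longleftrightarrow> m = (m' :: 'a \<Rightarrow>\<^sub>0 nat)"
proof
  assume "m + m = m' + m'"
  then have "Poly_Mapping.lookup m i + Poly_Mapping.lookup m i = Poly_Mapping.lookup m' i + Poly_Mapping.lookup m' i" for i
    by (metis lookup_add)
  then show "m = m'" by (intro poly_mapping_eqI) (metis add_left_cancel mult_2 nat_mult_eq_cancel1 zero_less_numeral)
qed simp

lemma count_concat_replicate:
  "distinct xs \<Longrightarrow> count (mset (concat (map (\<lambda>i. replicate (f i) i) xs))) j = (if j \<in> set xs then f j else 0)"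
  by (induction xs) auto

lemma lookup_wt_Ulabs: "Poly_Mapping.lookup (wt (map Ulab us)) i = 2 * count (mset us) i"
  by (induction us) (auto simp: lookup_add lookup_single)

definition mon :: "nat set \<Rightarrow> nat \<Rightarrow>\<^sub>0 nat" where
  "mon S = (\<Sum>i\<in>S. Poly_Mapping.single i 1)"

lemma lookup_mon: "finite S \<Longrightarrow> Poly_Mapping.lookup (mon S) i = (if i \<in> S then 1 else 0)"
  by (simp add: mon_def lookup_sum lookup_single when_def sum.delta)

lemma keys_mon: "finite S \<Longrightarrow> Poly_Mapping.keys (mon S) = S"
  by (auto simp: in_keys_iff lookup_mon split: if_splits)

lemma prod_Uvar: "finite S \<Longrightarrow> (\<Prod>i\<in>S. Uvar i) = frag_of (mon S)"
  by (induction S rule: finite_induct) (simp_all add: mon_def Uvar_def mult_single flip: single_one)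

context strands
begin

text \<open>The sorted list is a fixed choice of word for a monomial; other orders agree with it
  only modulo \<open>I\<close>. Exponents outside \<open>1..n\<close> are dropped, so these words
  are legal in every state.\<close>

definition ulist :: "(nat \<Rightarrow>\<^sub>0 nat) \<Rightarrow> nat list" where
  "ulist m = concat (map (\<lambda>i. replicate (Poly_Mapping.lookup m i) i) [1..<Suc n])"

abbreviation U :: "nat set \<Rightarrow> (nat \<Rightarrow>\<^sub>0 nat) \<Rightarrow> (nat set, arrow) path \<Rightarrow>\<^sub>0 int" where
  "U x m \<equiv> W x (map Ulab (ulist m))"

lemma count_ulist: "count (mset (ulist m)) j = (if j \<in> {1..n} then Poly_Mapping.lookup m j else 0)"
  unfolding ulist_def by (subst count_concat_replicate) auto

lemma set_ulist: "set (ulist m) = Poly_Mapping.keys m \<inter> {1..n}"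
  by (auto simp: ulist_def in_keys_iff)

lemma ulist_add: "mset (ulist (m + m')) = mset (ulist m @ ulist m')"
  by (rule multiset_eqI) (simp add: count_ulist lookup_add)

lemma wt_ulist: "Poly_Mapping.keys m \<subseteq> {1..n} \<Longrightarrow> wt (map Ulab (ulist m)) = m + m"
  by (rule poly_mapping_eqI) (auto simp: lookup_wt_Ulabs count_ulist lookup_add in_keys_iff subset_iff)

lemma ex_ulist:
  assumes "set us \<subseteq> {1..n}"
  shows "\<exists>m. Poly_Mapping.keys m = set us \<and> mset (ulist m) = mset us"
proof -
  define m where "m = sum_list (map (\<lambda>i. Poly_Mapping.single i (1::nat)) us)"
  have lookup: "Poly_Mapping.lookup m j = count (mset us) j" for j
    unfolding m_def by (induction us) (auto simp: lookup_add lookup_single)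
  have "mset (ulist m) = mset us"
    by (rule multiset_eqI) (use assms in \<open>auto simp: count_ulist lookup count_eq_zero_iff[symmetric]\<close>)
  moreover have "Poly_Mapping.keys m = set us"
    by (auto simp: in_keys_iff lookup)
  ultimately show ?thesis by blast
qed

lemma not_good_null: "\<not> good (set us) x \<Longrightarrow> null x (map Ulab us)"
  unfolding good_def using null_two_holes by blast

lemma frag_extend_I: "(\<And>m. m \<in> Poly_Mapping.keys d \<Longrightarrow> F m \<in> I) \<Longrightarrow> frag_extend F d \<in> I"
  unfolding frag_extend_def by (intro I_sum I_cmul)

text \<open>Applied to \<open>(0, x)\<close>, the word for m between \<open>u\<close> and
  \<open>v\<close> has weight 2m plus that of \<open>u @ v\<close>. Doubling is injective, so
  distinct monomials reach distinct basis vectors and coefficients can be read off. The contexts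
  \<open>u\<close> and \<open>v\<close> serve to compare the two sides of a commutation with a
  move.\<close>

lemma lookup_T_extend:
  assumes c: "Poly_Mapping.keys c \<subseteq> {m. Poly_Mapping.keys m \<subseteq> {1..n}}" and x: "x \<in> V" and ok: "oks (u @ v) x"
  shows "Poly_Mapping.lookup (frag_extend (\<lambda>p. T p (0, x)) (frag_extend (\<lambda>m. W x (u @ map Ulab (ulist m) @ v)) c))
      (m + m + wt (u @ v), acts (u @ v) x)
    = (if good (Poly_Mapping.keys m \<union> line ` set (u @ v)) (acts (u @ v) x) then Poly_Mapping.lookup c m else 0)"
proof -
  let ?y = "acts (u @ v) x" and ?S = "\<lambda>m. Poly_Mapping.keys m \<union> line ` set (u @ v)"
  have "Poly_Mapping.lookup (frag_extend (\<lambda>p. T p (0, x)) (W x (u @ map Ulab (ulist m') @ v))) (m + m + wt (u @ v), ?y)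
      = (if m' = m then if good (?S m) ?y then 1 else 0 else 0)" if "m' \<in> Poly_Mapping.keys c" for m'
  proof -
    let ?w = "u @ map Ulab (ulist m') @ v"
    have m': "Poly_Mapping.keys m' \<subseteq> {1..n}" using c that by auto
    have "line ` set ?w = ?S m'"
      using m' by (auto simp: set_ulist image_Un image_image)
    moreover have "wt ?w = m' + m' + wt (u @ v)" using wt_ulist[OF m'] by (simp add: ac_simps)
    moreover have "oks ?w x" "acts ?w x = ?y" using ok by (auto simp: set_ulist)
    ultimately have "frag_extend (\<lambda>p. T p (0, x)) (W x ?w)
        = (if good (?S m') ?y then frag_of (m' + m' + wt (u @ v), ?y) else 0)"
      using T_W[of 0 x x ?w] x by simp
    then show ?thesis by (auto simp: double_eq_iff)
  qed
  then have "Poly_Mapping.lookup (frag_extend (\<lambda>p. T p (0, x)) (frag_extend (\<lambda>m. W x (u @ map Ulab (ulist m) @ v)) c))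
      (m + m + wt (u @ v), ?y)
    = (\<Sum>m'\<in>Poly_Mapping.keys c. if m' = m then Poly_Mapping.lookup c m * (if good (?S m) ?y then 1 else 0) else 0)"
    unfolding frag_extend_frag_extend lookup_frag_extend by (intro sum.cong) auto
  then show ?thesis by (auto simp: sum.delta in_keys_iff)
qed

text \<open>Rewriting turns each closed word into zero or a word in the U letters; a word whose
  lines join two holes of \<open>x\<close> is null, so only supports that are good at
  \<open>x\<close> survive.\<close>

lemma closed_span:
  assumes "x \<in> V" "h \<in> frags_on {(u, p, v). (u, p, v) \<in> paths Q \<and> u = x \<and> v = x}"
  shows "\<exists>c. Poly_Mapping.keys c \<subseteq> {m. Poly_Mapping.keys m \<subseteq> {1..n} \<and> good (Poly_Mapping.keys m) x} \<and> h - frag_extend (U x) c \<in> I"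
  using assms(2) unfolding mem_Collect_eq
proof (induction h rule: frag_induction)
  case zero
  show ?case by (intro exI[of _ 0]) simp
next
  case (one q)
  then obtain w where w: "oks w x" "acts w x = x" "frag_of q = W x w"
    using assms(1) by (auto simp: paths_iff W_def)
  have null: ?case if "null x w"
    using that by (intro exI[of _ 0]) (simp add: null_def w)
  show ?case
  proof (cases "null x w")
    case False
    then obtain us where us: "set us \<subseteq> {1..n}" "eqv x w (map Ulab us)"
      using closed_word[OF assms(1) w(1,2)] by blast
    obtain m where m: "Poly_Mapping.keys m = set us" "mset (ulist m) = mset us"
      using ex_ulist[OF us(1)] by blast
    have "good (set us) x"
      using not_good_null eqv_null[OF us(2)] False by blast
    moreover have "eqv x w (map Ulab (ulist m))"
      using us(2) eqv_Ulabs_perm[OF m(2)[symmetric]] eqv_trans by blast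
    ultimately show ?thesis
      using m(1) us(1) by (intro exI[of _ "frag_of m"]) (simp add: w eqv_def)
  qed (rule null)
next
  case (diff a b)
  then obtain c d where c: "a - frag_extend (U x) c \<in> I" and d: "b - frag_extend (U x) d \<in> I"
    and keys: "Poly_Mapping.keys c \<subseteq> {m. Poly_Mapping.keys m \<subseteq> {1..n} \<and> good (Poly_Mapping.keys m) x}"
      "Poly_Mapping.keys d \<subseteq> {m. Poly_Mapping.keys m \<subseteq> {1..n} \<and> good (Poly_Mapping.keys m) x}"
    by blast
  have "a - b - frag_extend (U x) (c - d) \<in> I"
    using I_diff[OF c d] by (simp add: frag_extend_diff algebra_simps)
  then show ?case using keys_diff_subset[OF keys] by blast
qed

end

section \<open>The polynomial ring\<close>

lemma int_poly_ring_ops: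
  "carrier (int_poly_ring n) = {p. \<forall>m\<in>Poly_Mapping.keys p. Poly_Mapping.keys m \<subseteq> {1..n}}"
  "p \<otimes>\<^bsub>int_poly_ring n\<^esub> q = p * q" "p \<oplus>\<^bsub>int_poly_ring n\<^esub> q = p + q"
  "\<one>\<^bsub>int_poly_ring n\<^esub> = 1" "\<zero>\<^bsub>int_poly_ring n\<^esub> = 0"
  by (simp_all add: int_poly_ring_def)

lemma int_poly_ring_closed:
  assumes "p \<in> carrier (int_poly_ring n)" "q \<in> carrier (int_poly_ring n)"
  shows "p * q \<in> carrier (int_poly_ring n)" "p + q \<in> carrier (int_poly_ring n)" "- p \<in> carrier (int_poly_ring n)"
proof -
  have "Poly_Mapping.keys m \<subseteq> {1..n}" if m: "m \<in> Poly_Mapping.keys (p * q)" for m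
  proof -
    obtain a b where "m = a + b" "a \<in> Poly_Mapping.keys p" "b \<in> Poly_Mapping.keys q"
      using keys_mult[of p q] m by blast
    then show ?thesis using assms by (simp add: int_poly_ring_ops keys_add_nat)
  qed
  then show "p * q \<in> carrier (int_poly_ring n)" by (simp add: int_poly_ring_ops)
  show "p + q \<in> carrier (int_poly_ring n)"
    using assms Poly_Mapping.keys_add[of p q] unfolding int_poly_ring_ops by blast
  show "- p \<in> carrier (int_poly_ring n)"
    using assms by (simp add: int_poly_ring_ops)
qed

lemma int_poly_ring_ring: "ring (int_poly_ring n)"
proof (rule ringI)
  show "abelian_group (int_poly_ring n)"
  proof (rule abelian_groupI)
    fix p assume "p \<in> carrier (int_poly_ring n)"
    then show "\<exists>q\<in>carrier (int_poly_ring n). q \<oplus>\<^bsub>int_poly_ring n\<^esub> p = \<zero>\<^bsub>int_poly_ring n\<^esub>"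
      using int_poly_ring_closed(3) by (intro bexI[of _ "- p"]) (auto simp: int_poly_ring_ops(3,5))
  qed (use int_poly_ring_closed(2) in \<open>simp_all add: int_poly_ring_ops(3,5) ac_simps\<close>, simp add: int_poly_ring_ops(1))
  show "monoid (int_poly_ring n)"
    by (rule monoidI)
      (use int_poly_ring_closed(1) in \<open>simp_all add: int_poly_ring_ops(2,4) mult.assoc\<close>, simp add: int_poly_ring_ops(1))
qed (simp_all add: int_poly_ring_ops(2,3) algebra_simps)

lemma int_poly_ring_minus:
  "p \<in> carrier (int_poly_ring n) \<Longrightarrow> \<ominus>\<^bsub>int_poly_ring n\<^esub> p = - p"
  by (intro abelian_group.minus_equality ring.is_abelian_group int_poly_ring_ring)
    (simp_all add: int_poly_ring_closed(3)[of p _ p] int_poly_ring_ops(3,5))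

lemma monomial_generators_carrier:
  "{\<Prod>i\<in>S. Uvar i | S. S \<subseteq> {1..n} \<and> card S = k + 1} \<subseteq> carrier (int_poly_ring n)"
proof clarify
  fix S assume "S \<subseteq> {1..n}"
  then show "(\<Prod>i\<in>S. Uvar i) \<in> carrier (int_poly_ring n)"
    using finite_subset[of S "{1..n}"] by (auto simp: prod_Uvar keys_mon int_poly_ring_ops(1))
qed

lemma monomial_ideal_ideal: "ideal (monomial_ideal n k) (int_poly_ring n)"
  unfolding monomial_ideal_def
  by (intro ring.genideal_ideal int_poly_ring_ring monomial_generators_carrier)

text \<open>Choose k + 1 of the variables of a monomial; their product \<open>mon S\<close> is a
  generator and divides it.\<close>

lemma monomial_ideal_memI:
  assumes q: "q \<in> carrier (int_poly_ring n)" and k: "\<And>m. m \<in> Poly_Mapping.keys q \<Longrightarrow> k < card (Poly_Mapping.keys m)"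
  shows "q \<in> monomial_ideal n k"
proof -
  note J = monomial_ideal_ideal[of n k]
  note J' = ideal.axioms(1)[OF J]
  have "Poly_Mapping.keys q \<subseteq> {m. Poly_Mapping.keys m \<subseteq> {1..n} \<and> k < card (Poly_Mapping.keys m)}"
    using q k by (auto simp: int_poly_ring_ops(1))
  then show ?thesis
  proof (induction q rule: frag_induction)
    case zero
    show ?case
      using additive_subgroup.zero_closed[OF J'] unfolding int_poly_ring_ops(5) .
  next
    case (one m)
    then have "k + 1 \<le> card (Poly_Mapping.keys m)" by simp
    then obtain S where S: "S \<subseteq> Poly_Mapping.keys m" "card S = k + 1"
      by (rule obtain_subset_with_card_n)
    then have fin: "finite S" using finite_subset finite_keys by blast
    \<comment> \<open>Subtraction of exponents is truncated; it is exact here because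
      \<open>S\<close> lies in the support of \<open>m\<close>.\<close>
    define m0 where "m0 = m - mon S"
    have m0: "m = m0 + mon S"
    proof (rule poly_mapping_eqI)
      fix i
      have "Poly_Mapping.lookup m i \<noteq> 0" if "i \<in> S" using S(1) that by (auto simp: in_keys_iff)
      then show "Poly_Mapping.lookup m i = Poly_Mapping.lookup (m0 + mon S) i"
        by (auto simp: m0_def lookup_add lookup_minus lookup_mon[OF fin])
    qed
    have "(\<Prod>i\<in>S. Uvar i) \<in> monomial_ideal n k"
      unfolding monomial_ideal_def
      using ring.genideal_self[OF int_poly_ring_ring monomial_generators_carrier[of n k]] S one by blast
    moreover have "frag_of m0 \<in> carrier (int_poly_ring n)"
      using one m0 by (auto simp: int_poly_ring_ops(1) keys_add_nat)
    ultimately have "frag_of m0 * (\<Prod>i\<in>S. Uvar i) \<in> monomial_ideal n k"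
      using ideal.I_l_closed[OF J] by (simp add: int_poly_ring_ops(2))
    then show ?case by (simp add: prod_Uvar[OF fin] mult_single m0)
  next
    case (diff a b)
    have "a + \<ominus>\<^bsub>int_poly_ring n\<^esub> b \<in> monomial_ideal n k"
      using additive_subgroup.a_closed[OF J' diff(1) additive_subgroup.a_inv_closed[OF J' diff(2)]] by (simp add: int_poly_ring_ops(3))
    then show ?case using int_poly_ring_minus[OF ideal.Icarr[OF J diff(2)]] by simp
  qed
qed

section \<open>The center\<close>

context end_truncation
begin

definition Z :: "(nat \<Rightarrow>\<^sub>0 nat) \<Rightarrow> (nat set, arrow) path \<Rightarrow>\<^sub>0 int" where
  "Z m = (\<Sum>x\<in>X. U x m)"

text \<open>An integer polynomial is literally a formal sum of exponent vectors, so the tools for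
  free abelian groups apply to it directly.\<close>

definition \<theta> :: "((nat \<Rightarrow>\<^sub>0 nat) \<Rightarrow>\<^sub>0 int) \<Rightarrow> (nat set, arrow) path \<Rightarrow>\<^sub>0 int" where
  "\<theta> q = frag_extend Z q"

lemma \<theta>_simps [simp]: "\<theta> 0 = 0" "\<theta> (frag_of m) = Z m" "\<theta> (p + q) = \<theta> p + \<theta> q" "\<theta> (p - q) = \<theta> p - \<theta> q"
  by (simp_all add: \<theta>_def frag_extend_add frag_extend_diff)

lemma \<theta>_AX: "\<theta> q \<in> AX"
proof (induction q rule: frag_induction[OF subset_UNIV])
  case (2 m)
  show ?case unfolding \<theta>_simps Z_def by (intro AX_sum W_AX) simp_all
qed (simp_all add: AX_closed)

lemma \<theta>_sum: "\<theta> q = (\<Sum>x\<in>X. frag_extend (U x) q)"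
  by (induction q rule: frag_induction[OF subset_UNIV]) (simp_all add: Z_def frag_extend_diff sum_subtractf)

lemma W_mult_\<theta>: "x \<in> X \<Longrightarrow> W x [] \<odot> \<theta> q = frag_extend (U x) q"
  by (induction q rule: frag_induction[OF subset_UNIV])
    (simp_all add: Z_def path_mult_diff path_mult_sum_right W_mult finite_X frag_extend_diff)

text \<open>The product concatenates two sorted lists, and sorting the result costs an element of
  \<open>I\<close>. For this reason \<open>\<theta>\<close> is shown to be multiplicative modulo
  \<open>I\<close>.\<close>

lemma Z_mult: "Z m \<odot> Z m' - Z (m + m') \<in> I"
proof -
  have "Z m \<odot> Z m' = (\<Sum>x\<in>X. W x (map Ulab (ulist m @ ulist m')))"
    by (simp add: Z_def path_mult_sum_left path_mult_sum_right W_mult finite_X)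
  moreover have "(\<Sum>x\<in>X. W x (map Ulab (ulist m @ ulist m')) - U x (m + m')) \<in> I"
    using eqv_Ulabs_perm[OF ulist_add[symmetric]] by (intro I_sum) (simp add: eqv_def)
  ultimately show ?thesis by (simp add: Z_def sum_subtractf)
qed

lemma \<theta>_mult: "\<theta> p \<odot> \<theta> q - \<theta> (p * q) \<in> I"
proof (induction p rule: frag_induction[OF subset_UNIV])
  case (2 m)
  show ?case
  proof (induction q rule: frag_induction[OF subset_UNIV])
    case (2 m')
    show ?case using Z_mult by (simp add: mult_single)
  next
    case (3 a b)
    then show ?case using I_diff[OF 3] by (simp add: path_mult_diff right_diff_distrib algebra_simps)
  qed simp
next
  case (3 a b)
  then show ?case using I_diff[OF 3] by (simp add: path_mult_diff left_diff_distrib algebra_simps)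
qed simp

lemma \<theta>_1: "\<theta> 1 = E"
proof -
  have "ulist 0 = []" by (simp add: ulist_def)
  then show ?thesis by (simp add: Z_def E_def flip: single_one)
qed

lemma \<theta>_central:
  assumes "g \<in> AX"
  shows "\<theta> q \<odot> g - g \<odot> \<theta> q \<in> I"
proof (induction q rule: frag_induction[OF subset_UNIV])
  case (2 m)
  show ?case using assms
  proof (induction g rule: AX_induct)
    case (path x w)
    have "Z m \<odot> W x w = W x (map Ulab (ulist m) @ w)" "W x w \<odot> Z m = W x (w @ map Ulab (ulist m))"
      using path finite_X by (simp_all add: Z_def path_mult_sum_left path_mult_sum_right W_mult)
    then show ?case using eqv_through_Ulabs[of x "ulist m" w] by (simp add: eqv_def)
  next
    case (diff a b)
    then show ?case using I_diff[OF diff] by (simp add: path_mult_diff algebra_simps)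
  qed simp
next
  case (3 a b)
  then show ?case using I_diff[OF 3] by (simp add: path_mult_diff algebra_simps)
qed simp

section \<open>The kernel of the map from polynomials\<close>

lemma ex_good_X: "S \<subseteq> {1..n} \<Longrightarrow> card S \<le> k \<Longrightarrow> \<exists>x\<in>X. good S x"
  using ex_good[of S] k_le e_end unfolding X_def by blast

text \<open>A monomial with at most k variables has a good state in \<open>X\<close>, where the
  representation detects its coefficient. Conversely, the preimage of \<open>I\<close> is an ideal,
  and a generator involves k + 1 lines, for which no state is good.\<close>

lemma \<theta>_kernel:
  assumes q: "q \<in> carrier (int_poly_ring n)"
  shows "\<theta> q \<in> I \<longleftrightarrow> q \<in> monomial_ideal n k"
proof
  assume \<theta>: "\<theta> q \<in> I"
  show "q \<in> monomial_ideal n k"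
  proof (rule monomial_ideal_memI[OF q], rule ccontr)
    fix m assume m: "m \<in> Poly_Mapping.keys q" "\<not> k < card (Poly_Mapping.keys m)"
    have keys: "Poly_Mapping.keys q \<subseteq> {m. Poly_Mapping.keys m \<subseteq> {1..n}}"
      using q by (auto simp: int_poly_ring_ops(1))
    then obtain x where x: "x \<in> X" "good (Poly_Mapping.keys m) x"
      using ex_good_X[of "Poly_Mapping.keys m"] m by auto
    have "frag_extend (U x) q \<in> I"
      unfolding W_mult_\<theta>[OF x(1), symmetric] using \<theta> W_paths by (rule I_mult_left)
    then have "frag_extend (\<lambda>p. T p (0, x)) (frag_extend (U x) q) = 0" by (rule T_I)
    then have "Poly_Mapping.lookup q m = 0"
      using lookup_T_extend[OF keys X_V[OF x(1)], of "[]" "[]" m] x(2) by simp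
    then show False using m(1) by (simp add: in_keys_iff)
  qed
next
  have "ideal {q \<in> carrier (int_poly_ring n). \<theta> q \<in> I} (int_poly_ring n)"
  proof (rule idealI[OF int_poly_ring_ring])
    interpret R: ring "int_poly_ring n" by (rule int_poly_ring_ring)
    show "subgroup {q \<in> carrier (int_poly_ring n). \<theta> q \<in> I} (add_monoid (int_poly_ring n))"
    proof (rule R.add.subgroupI)
      have "0 \<in> carrier (int_poly_ring n)" by (simp add: int_poly_ring_ops(1))
      then show "{q \<in> carrier (int_poly_ring n). \<theta> q \<in> I} \<noteq> {}" by force
    next
      fix a assume a: "a \<in> {q \<in> carrier (int_poly_ring n). \<theta> q \<in> I}"
      then have "\<theta> (0 - a) \<in> I" unfolding \<theta>_simps by (intro I_diff) simp_all
      then show "\<ominus>\<^bsub>int_poly_ring n\<^esub> a \<in> {q \<in> carrier (int_poly_ring n). \<theta> q \<in> I}"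
        using a int_poly_ring_closed(3)[of a n a] int_poly_ring_minus[of a n] by simp
    next
      fix a b assume "a \<in> {q \<in> carrier (int_poly_ring n). \<theta> q \<in> I}" "b \<in> {q \<in> carrier (int_poly_ring n). \<theta> q \<in> I}"
      then show "a \<oplus>\<^bsub>int_poly_ring n\<^esub> b \<in> {q \<in> carrier (int_poly_ring n). \<theta> q \<in> I}"
        using int_poly_ring_closed(2)[of a n b] I_add by (simp add: int_poly_ring_ops(3))
    qed simp
  next
    fix a b assume "a \<in> {q \<in> carrier (int_poly_ring n). \<theta> q \<in> I}" and b: "b \<in> carrier (int_poly_ring n)"
    then have a: "a \<in> carrier (int_poly_ring n)" "\<theta> a \<in> I" by auto
    have "\<theta> b \<odot> \<theta> a \<in> I" "\<theta> a \<odot> \<theta> b \<in> I"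
      using I_mult_left[OF a(2)] I_mult_right[OF a(2)] AX_paths[OF \<theta>_AX] by blast+
    then have "\<theta> (b * a) \<in> I" "\<theta> (a * b) \<in> I"
      using I_diff[OF _ \<theta>_mult[of b a]] I_diff[OF _ \<theta>_mult[of a b]] by fastforce+
    then show "b \<otimes>\<^bsub>int_poly_ring n\<^esub> a \<in> {q \<in> carrier (int_poly_ring n). \<theta> q \<in> I}"
      "a \<otimes>\<^bsub>int_poly_ring n\<^esub> b \<in> {q \<in> carrier (int_poly_ring n). \<theta> q \<in> I}"
      using int_poly_ring_closed(1)[OF a(1) b] int_poly_ring_closed(1)[OF b a(1)]
      by (simp_all add: int_poly_ring_ops(2))
  qed
  moreover have "\<theta> (\<Prod>i\<in>S. Uvar i) \<in> I" if S: "S \<subseteq> {1..n}" "card S = k + 1" for S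
  proof -
    have fin: "finite S" using S finite_subset by blast
    have "set (ulist (mon S)) = S" using S by (auto simp: set_ulist keys_mon[OF fin])
    then have "U x (mon S) \<in> I" if "x \<in> X" for x
      using not_good_null[of "ulist (mon S)" x] good_card[OF X_V[OF that] _ S(1)] S(2)
      by (force simp: null_def)
    then show ?thesis unfolding prod_Uvar[OF fin] \<theta>_simps Z_def by (rule I_sum)
  qed
  then have "{\<Prod>i\<in>S. Uvar i | S. S \<subseteq> {1..n} \<and> card S = k + 1} \<subseteq> {q \<in> carrier (int_poly_ring n). \<theta> q \<in> I}"
    using monomial_generators_carrier[of n k] by blast
  ultimately have "monomial_ideal n k \<subseteq> {q \<in> carrier (int_poly_ring n). \<theta> q \<in> I}"
    unfolding monomial_ideal_def by (intro ring.genideal_minimal[OF int_poly_ring_ring])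
  moreover assume "q \<in> monomial_ideal n k"
  ultimately show "\<theta> q \<in> I" by blast
qed

text \<open>Commuting with the idempotent at \<open>x\<close> shows that, modulo \<open>I\<close>,
  the paths of \<open>f\<close> leaving \<open>x\<close> may be cut down to those returning to
  \<open>x\<close>; the sum over \<open>x\<close> gives the claim.\<close>

lemma center_diagonal:
  assumes f: "f \<in> AX" "\<And>g. g \<in> AX \<Longrightarrow> f \<odot> g - g \<odot> f \<in> I"
  shows "f - (\<Sum>x\<in>X. W x [] \<odot> f \<odot> W x []) \<in> I"
proof -
  have "W x [] \<odot> f - W x [] \<odot> f \<odot> W x [] \<in> I" if x: "x \<in> X" for x
  proof -
    have "W x [] \<in> AX" using W_AX[of x "[]"] x by simp
    then have "W x [] \<odot> (f \<odot> W x [] - W x [] \<odot> f) \<in> I"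
      by (intro I_mult_left W_paths f(2))
    then have "- (W x [] \<odot> (f \<odot> W x [] - W x [] \<odot> f)) \<in> I" by (rule I_minus)
    moreover have "W x [] \<odot> (W x [] \<odot> f) = W x [] \<odot> f"
      by (simp add: path_mult_assoc[symmetric] W_mult)
    ultimately show ?thesis by (simp add: path_mult_diff path_mult_assoc)
  qed
  then have "(\<Sum>x\<in>X. W x [] \<odot> f - W x [] \<odot> f \<odot> W x []) \<in> I" by (rule I_sum)
  moreover have "(\<Sum>x\<in>X. W x [] \<odot> f) = f"
    using E_mult(1)[OF f(1)] by (simp add: E_def path_mult_sum_left)
  ultimately show ?thesis by (simp add: sum_subtractf)
qed

text \<open>Commute with a single move from x to y: one product carries the coefficients at x, the
  other those at y, and both send the monomial to the same basis vector. That vector is nonzero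
  exactly under the condition that \<open>good_connected\<close> puts on a step.\<close>

lemma center_coefficients:
  assumes c: "\<And>x. x \<in> X \<Longrightarrow> Poly_Mapping.keys (c x) \<subseteq> {m. Poly_Mapping.keys m \<subseteq> {1..n}}"
    and central: "\<And>g. g \<in> AX \<Longrightarrow> (\<Sum>x\<in>X. frag_extend (U x) (c x)) \<odot> g - g \<odot> (\<Sum>x\<in>X. frag_extend (U x) (c x)) \<in> I"
    and xy: "x \<in> X" "good (Poly_Mapping.keys m) x" "y \<in> X" "good (Poly_Mapping.keys m) y"
  shows "Poly_Mapping.lookup (c x) m = Poly_Mapping.lookup (c y) m"
proof (rule good_connected[OF e_end, of "Poly_Mapping.keys m" "\<lambda>x. Poly_Mapping.lookup (c x) m" x y])
  fix x l assume x: "x \<in> V" "e \<notin> x" and l: "is_move l" "ok l x" "e \<notin> act l x"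
    and good: "good (insert (line l) (Poly_Mapping.keys m)) x"
  let ?y = "act l x" and ?g = "\<Sum>x\<in>X. frag_extend (U x) (c x)"
  have X: "x \<in> X" "?y \<in> X" using x l act_V by (auto simp: X_def)
  have good': "good (insert (line l) (Poly_Mapping.keys m)) ?y" using good good_act[OF l(2)] by simp
  have U_l: "frag_extend (U z) d \<odot> W x [l] = (if z = x then frag_extend (\<lambda>m. W x ([] @ map Ulab (ulist m) @ [l])) d else 0)" for z d
    by (induction d rule: frag_induction[OF subset_UNIV]) (simp_all add: W_mult frag_extend_diff path_mult_diff)
  have l_U: "W x [l] \<odot> frag_extend (U z) d = (if z = ?y then frag_extend (\<lambda>m. W x ([l] @ map Ulab (ulist m) @ [])) d else 0)" for z d
    by (induction d rule: frag_induction[OF subset_UNIV]) (simp_all add: W_mult frag_extend_diff path_mult_diff)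
  have "W x [l] \<in> AX" using X by (intro W_AX) simp_all
  then have "?g \<odot> W x [l] - W x [l] \<odot> ?g \<in> I" by (rule central)
  moreover have "?g \<odot> W x [l] = frag_extend (\<lambda>m. W x ([] @ map Ulab (ulist m) @ [l])) (c x)"
    using X finite_X by (simp add: path_mult_sum_left U_l)
  moreover have "W x [l] \<odot> ?g = frag_extend (\<lambda>m. W x ([l] @ map Ulab (ulist m) @ [])) (c ?y)"
    using X finite_X by (simp add: path_mult_sum_right l_U)
  ultimately have "frag_extend (\<lambda>m. W x ([] @ map Ulab (ulist m) @ [l])) (c x)
      - frag_extend (\<lambda>m. W x ([l] @ map Ulab (ulist m) @ [])) (c ?y) \<in> I"
    by (simp only:)
  from T_I[OF this, of "(0, x)"]
  have "frag_extend (\<lambda>p. T p (0, x)) (frag_extend (\<lambda>m. W x ([] @ map Ulab (ulist m) @ [l])) (c x))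
      = frag_extend (\<lambda>p. T p (0, x)) (frag_extend (\<lambda>m. W x ([l] @ map Ulab (ulist m) @ [])) (c ?y))"
    by (simp only: frag_extend_diff right_minus_eq)
  then show "Poly_Mapping.lookup (c ?y) m = Poly_Mapping.lookup (c x) m"
    using lookup_T_extend[OF c[OF X(1)] x(1), of "[]" "[l]" m] lookup_T_extend[OF c[OF X(2)] x(1), of "[l]" "[]" m]
      l good' by simp
qed (use xy in \<open>auto simp: X_def\<close>)

text \<open>The corners of a central element give one polynomial for each state, and their
  coefficients agree at all states where the monomial is good. They are glued into one polynomial by
  taking each coefficient from any good state.\<close>

lemma center_generated:
  assumes f: "f \<in> AX" "\<And>g. g \<in> AX \<Longrightarrow> f \<odot> g - g \<odot> f \<in> I"
  shows "\<exists>q\<in>carrier (int_poly_ring n). f - \<theta> q \<in> I"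
proof -
  let ?c = "\<lambda>x c. Poly_Mapping.keys c \<subseteq> {m. Poly_Mapping.keys m \<subseteq> {1..n} \<and> good (Poly_Mapping.keys m) x}
      \<and> W x [] \<odot> f \<odot> W x [] - frag_extend (U x) c \<in> I"
  have "\<forall>x\<in>X. \<exists>c. ?c x c"
    by (intro ballI closed_span sandwich_pathsX X_V AX_paths f(1))
  then obtain c where "\<forall>x\<in>X. ?c x (c x)" by (rule bchoice[THEN exE])
  then have c: "\<And>x. x \<in> X \<Longrightarrow> Poly_Mapping.keys (c x) \<subseteq> {m. Poly_Mapping.keys m \<subseteq> {1..n} \<and> good (Poly_Mapping.keys m) x}"
      "\<And>x. x \<in> X \<Longrightarrow> W x [] \<odot> f \<odot> W x [] - frag_extend (U x) (c x) \<in> I"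
    by blast+
  define g where "g = (\<Sum>x\<in>X. frag_extend (U x) (c x))"
  have "(\<Sum>x\<in>X. W x [] \<odot> f \<odot> W x [] - frag_extend (U x) (c x)) \<in> I" using c(2) by (rule I_sum)
  then have fg: "f - g \<in> I"
    using I_add[OF center_diagonal[OF f]] by (fastforce simp: g_def sum_subtractf)
  have central: "g \<odot> h - h \<odot> g \<in> I" if h: "h \<in> AX" for h
  proof -
    have "(f - g) \<odot> h - h \<odot> (f - g) \<in> I"
      by (rule I_diff[OF I_mult_right[OF fg AX_paths[OF h]] I_mult_left[OF fg AX_paths[OF h]]])
    then have "(f \<odot> h - h \<odot> f) - ((f - g) \<odot> h - h \<odot> (f - g)) \<in> I" by (rule I_diff[OF f(2)[OF h]])
    then show ?thesis by (simp add: path_mult_diff algebra_simps)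
  qed
  define M where "M = (\<Union>x\<in>X. Poly_Mapping.keys (c x))"
  \<comment> \<open>The choice of good state does not matter, as the coefficients agree there; where
    \<open>m\<close> is not good its word is null, so any coefficient is right modulo
    \<open>I\<close>.\<close>
  define y where "y m = (SOME x. x \<in> X \<and> good (Poly_Mapping.keys m) x)" for m :: "nat \<Rightarrow>\<^sub>0 nat"
  define q where "q = (\<Sum>m\<in>M. frag_cmul (Poly_Mapping.lookup (c (y m)) m) (frag_of m))"
  have "finite M" using finite_X by (simp add: M_def)
  then have lookup_q: "Poly_Mapping.lookup q m = (if m \<in> M then Poly_Mapping.lookup (c (y m)) m else 0)" for m
    by (simp add: q_def lookup_sum if_distrib[of "\<lambda>t. _ * t"] cong: if_cong)
  have keys_c: "Poly_Mapping.keys (c x) \<subseteq> {m. Poly_Mapping.keys m \<subseteq> {1..n}}" if "x \<in> X" for x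
    using c(1)[OF that] by blast
  have agree: "Poly_Mapping.lookup q m = Poly_Mapping.lookup (c x) m"
    if x: "x \<in> X" "good (Poly_Mapping.keys m) x" for x m
  proof (cases "m \<in> M")
    case True
    have "y m \<in> X \<and> good (Poly_Mapping.keys m) (y m)" unfolding y_def by (rule someI[of _ x]) (use x in simp)
    then have "Poly_Mapping.lookup (c (y m)) m = Poly_Mapping.lookup (c x) m"
      using central x unfolding g_def by (intro center_coefficients[OF keys_c]) auto
    then show ?thesis by (simp add: lookup_q True)
  next
    case False
    then have "m \<notin> Poly_Mapping.keys (c x)" using x by (auto simp: M_def)
    then show ?thesis by (simp add: lookup_q False in_keys_iff)
  qed
  \<comment> \<open>By \<open>agree\<close>, only monomials that are not good at \<open>x\<close>,
    hence null there, remain in the difference \<open>c x - q\<close>.\<close>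
  have "frag_extend (U x) (c x) - frag_extend (U x) q \<in> I" if x: "x \<in> X" for x
    unfolding frag_extend_diff[symmetric]
  proof (rule frag_extend_I)
    fix m assume m: "m \<in> Poly_Mapping.keys (c x - q)"
    then have "\<not> good (Poly_Mapping.keys m) x"
      using agree[OF x, of m] by (auto simp: in_keys_iff lookup_minus)
    moreover have "m \<in> M"
      using m lookup_q[of m] x by (auto simp: in_keys_iff lookup_minus M_def split: if_splits)
    then have "Poly_Mapping.keys m \<subseteq> {1..n}" using keys_c by (auto simp: M_def)
    then have "set (ulist m) = Poly_Mapping.keys m" by (auto simp: set_ulist)
    ultimately show "U x m \<in> I"
      using not_good_null[of "ulist m" x] by (simp add: null_def)
  qed
  then have "(\<Sum>x\<in>X. frag_extend (U x) (c x) - frag_extend (U x) q) \<in> I" by (rule I_sum)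
  then have "g - \<theta> q \<in> I" by (simp add: \<theta>_sum g_def sum_subtractf)
  then have "f - \<theta> q \<in> I" using I_add[OF fg] by fastforce
  moreover have "Poly_Mapping.keys q \<subseteq> M" using lookup_q by (auto simp: in_keys_iff split: if_splits)
  then have "q \<in> carrier (int_poly_ring n)" using keys_c unfolding int_poly_ring_ops(1) M_def by blast
  ultimately show ?thesis by blast
qed

section \<open>The isomorphism with the center\<close>

lemma \<theta>_ring_hom: "ring_hom_ring (int_poly_ring n) B (\<lambda>q. \<pi> (\<theta> q))"
proof (rule ring_hom_ringI2[OF int_poly_ring_ring B_ring])
  show "(\<lambda>q. \<pi> (\<theta> q)) \<in> ring_hom (int_poly_ring n) B"
  proof (rule ring_hom_memI)
    fix p q assume "p \<in> carrier (int_poly_ring n)" "q \<in> carrier (int_poly_ring n)"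
    have "\<pi> (\<theta> (p * q)) = \<pi> (\<theta> p \<odot> \<theta> q)"
      using \<theta>_mult[of p q] by (metis \<pi>_eq_iff)
    then show "\<pi> (\<theta> (p \<otimes>\<^bsub>int_poly_ring n\<^esub> q)) = \<pi> (\<theta> p) \<otimes>\<^bsub>B\<^esub> \<pi> (\<theta> q)"
      by (simp add: int_poly_ring_ops(2) B_ops \<theta>_AX)
    show "\<pi> (\<theta> (p \<oplus>\<^bsub>int_poly_ring n\<^esub> q)) = \<pi> (\<theta> p) \<oplus>\<^bsub>B\<^esub> \<pi> (\<theta> q)"
      by (simp add: int_poly_ring_ops(3) B_ops \<theta>_AX)
  next
    show "\<pi> (\<theta> \<one>\<^bsub>int_poly_ring n\<^esub>) = \<one>\<^bsub>B\<^esub>" by (simp add: int_poly_ring_ops(4) \<theta>_1 B_one)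
  qed (simp add: carrier_B \<theta>_AX)
qed

lemma center_iso:
  "\<exists>\<phi>. \<phi> \<in> ring_iso (U_ring n k) (ring_center B) \<and>
     (\<forall>i\<in>{1..n}. \<phi> (U_elem n k i) = (\<Oplus>\<^bsub>B\<^esub>x\<in>X. U_at n k i x))"
proof -
  let ?\<psi> = "\<lambda>q. \<pi> (\<theta> q)" and ?R = "int_poly_ring n"
  interpret h: ring_hom_ring ?R B ?\<psi> by (rule \<theta>_ring_hom)
  have kernel: "a_kernel ?R B ?\<psi> = monomial_ideal n k"
  proof -
    have "\<pi> (\<theta> q) = \<zero>\<^bsub>B\<^esub> \<longleftrightarrow> q \<in> monomial_ideal n k" if "q \<in> carrier ?R" for q
      using \<theta>_kernel[OF that] by (simp add: B_ops \<pi>_eq_iff)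
    moreover have "monomial_ideal n k \<subseteq> carrier ?R"
      using ideal.Icarr[OF monomial_ideal_ideal] by blast
    ultimately show ?thesis unfolding a_kernel_def' by blast
  qed
  have "?\<psi> ` carrier ?R = carrier (ring_center B)"
  proof (intro equalityI subsetI)
    fix z assume "z \<in> ?\<psi> ` carrier ?R"
    then show "z \<in> carrier (ring_center B)"
      unfolding carrier_center_B using \<theta>_AX \<theta>_central by blast
  next
    fix z assume "z \<in> carrier (ring_center B)"
    then obtain f where f: "z = \<pi> f" "f \<in> AX" "\<And>g. g \<in> AX \<Longrightarrow> f \<odot> g - g \<odot> f \<in> I"
      unfolding carrier_center_B by blast
    then obtain q where "q \<in> carrier ?R" "f - \<theta> q \<in> I"
      using center_generated by blast
    then show "z \<in> ?\<psi> ` carrier ?R" using f(1) \<pi>_eq_iff by blast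
  qed
  \<comment> \<open>\<open>ring_center\<close> changes only the carrier, so the image with the
    operations of \<open>B\<close> is literally the center, in the form in which the first
    isomorphism theorem delivers it.\<close>
  then have center: "B\<lparr>carrier := ?\<psi> ` carrier ?R\<rparr> = ring_center B"
    by (simp add: ring_center_def)
  have "(\<lambda>Y. the_elem (?\<psi> ` Y)) \<in> ring_iso (U_ring n k) (ring_center B)"
    using h.FactRing_iso_set_aux unfolding kernel center U_ring_def .
  moreover have "the_elem (?\<psi> ` U_elem n k i) = (\<Oplus>\<^bsub>B\<^esub>x\<in>X. U_at n k i x)" if i: "i \<in> {1..n}" for i
  proof -
    have "Uvar i \<in> carrier ?R" using i by (simp add: Uvar_def int_poly_ring_ops(1))
    then have "the_elem (?\<psi> ` U_elem n k i) = \<pi> (\<theta> (Uvar i))"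
      using h.the_elem_simp unfolding kernel U_elem_def by blast
    also have "\<theta> (Uvar i) = (\<Sum>x\<in>X. U x (Poly_Mapping.single i 1))"
      by (simp add: Uvar_def Z_def)
    also have "\<pi> \<dots> = \<pi> (\<Sum>x\<in>X. W x [Ulab i])"
    proof -
      have "mset (ulist (Poly_Mapping.single i 1)) = mset [i]"
        by (rule multiset_eqI) (use i in \<open>auto simp: count_ulist lookup_single\<close>)
      then have "U x (Poly_Mapping.single i 1) - W x [Ulab i] \<in> I" for x
        using eqv_Ulabs_perm[of "ulist (Poly_Mapping.single i 1)" "[i]" x] by (simp add: eqv_def)
      then show ?thesis unfolding \<pi>_eq_iff sum_subtractf[symmetric] by (intro I_sum)
    qed
    also have "\<dots> = (\<Oplus>\<^bsub>B\<^esub>x\<in>X. \<pi> (W x [Ulab i]))"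
      by (rule \<pi>_sum_B[symmetric]) (simp_all add: finite_X W_AX)
    also have "\<dots> = (\<Oplus>\<^bsub>B\<^esub>x\<in>X. U_at n k i x)"
      using i by (intro h.S.finsum_cong') (auto simp: U_at_W X_V carrier_B W_AX)
    finally show ?thesis .
  qed
  ultimately show ?thesis by blast
qed

end

theorem corollary4p14:
  fixes n k :: nat
  assumes "n \<ge> 1" and "k \<le> n"
  shows "(\<exists>\<phi>. \<phi> \<in> ring_iso (U_ring n k) (ring_center (B_l n k)) \<and>
            (\<forall>i\<in>{1..n}. \<phi> (U_elem n k i) = (\<Oplus>\<^bsub>B_l n k\<^esub>x\<in>V_l n k. U_at n k i x))) \<and>
         (\<exists>\<phi>. \<phi> \<in> ring_iso (U_ring n k) (ring_center (B_r n k)) \<and>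
            (\<forall>i\<in>{1..n}. \<phi> (U_elem n k i) = (\<Oplus>\<^bsub>B_r n k\<^esub>x\<in>V_r n k. U_at n k i x)))"
proof -
  interpret l: end_truncation n k n by unfold_locales (use assms in simp_all)
  interpret r: end_truncation n k 0 by unfold_locales (use assms in simp_all)
  \<comment> \<open>This is where \<open>n \<ge> 1\<close> enters: for \<open>n = 0\<close>
    truncated subtraction would leave \<open>n\<close> in the left set.\<close>
  have "{0..n - 1} = {0..n} - {n}" "{1..n} = {0..n} - {0}" using assms(1) by auto
  then have "V_l n k = l.X" "V_r n k = r.X"
    by (auto simp: V_l_def V_r_def l.X_def r.X_def Vset_def)
  then show ?thesis
    using l.center_iso r.center_iso unfolding B_l_def B_r_def by simp
qed

end
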